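(* Let $d\ge1$ be an integer, let $|\cdot|$ be a norm on $\mathbb{R}^d$, and let $q>p\ge1$ be real numbers such that either $p<\frac{dq}{q+d}$, or ($\frac{dq}{q+d}<p$ and $p\neq d$). There exists a real constant $\kappa_{p,q,d}>0$ (depending only on $p$, $q$, $d$ and the fixed norm) such that, for all probability measures $\mu,\nu$ on $\mathbb{R}^d$ with finite $q$-moments, $$\mathcal{W}_p^p(\mu,\nu)\le\kappa_{p,q,d}\,\big(M_{\frac{\mu+\nu}2}(q)\vee1\big)\begin{cases}D^{\infty}(\mu,\nu)^{\frac pd}&\text{if }p<\frac{dq}{q+d},\\[1mm] D^{\infty}(\mu,\nu)^{1-\frac pq}&\text{if }\frac{dq}{q+d}<p\text{ and }p\ne d,\end{cases}$$ where $M_{\frac{\mu+\nu}2}(q)=\frac12\int_{\mathbb{R}^d}|\xi|^q\,(\mu+\nu)(d\xi)$.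
   Context: $\mathcal{W}_p$ denotes the $p$-Wasserstein distance on $\mathbb{R}^d$ associated with the norm $|\cdot|$: $\mathcal{W}_p(\mu,\nu)=\inf\{(\mathbb{E}|X-Y|^p)^{1/p}: X\sim\mu,\ Y\sim\nu\}$, and $\mathcal{W}_p^p=(\mathcal{W}_p)^p$. The uniform discrepancy between probability measures on $\mathbb{R}^d$ is $D^{\infty}(\mu,\nu)=\sup_{x,y\in\mathbb{R}^d}|\mu([x,y])-\nu([x,y])|$, where $[x,y]=\prod_{i=1}^d[x^i,y^i]$ if $x^i\le y^i$ for all $i$, and $[x,y]=\varnothing$ otherwise. $a\vee b=\max(a,b)$. *)

theory Defs
  imports "HOL-Probability.Probability"
begin

definition is_norm :: "('a::real_vector \<Rightarrow> real) \<Rightarrow> bool" where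
  "is_norm N \<longleftrightarrow>
     (\<forall>x. 0 \<le> N x) \<and>
     (\<forall>x. N x = 0 \<longleftrightarrow> x = 0) \<and>
     (\<forall>c x. N (c *\<^sub>R x) = \<bar>c\<bar> * N x) \<and>
     (\<forall>x y. N (x + y) \<le> N x + N y)"

(* Only used with positive exponents a, so that infinity is sent to infinity. *)
definition ennreal_powr :: "ennreal \<Rightarrow> real \<Rightarrow> ennreal" where
  "ennreal_powr x a = (if x = \<top> then \<top> else ennreal (enn2real x powr a))"

(* Joint laws of pairs (X, Y) with X distributed as \<mu> and Y as \<nu>. *)
definition couplings :: "'a measure \<Rightarrow> 'b measure \<Rightarrow> ('a \<times> 'b) measure set" where
  "couplings \<mu> \<nu> = {\<pi>. prob_space \<pi> \<and> sets \<pi> = sets (\<mu> \<Otimes>\<^sub>M \<nu>) \<and>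
     distr \<pi> \<mu> fst = \<mu> \<and> distr \<pi> \<nu> snd = \<nu>}"

definition wasserstein ::
  "('a::real_vector \<Rightarrow> real) \<Rightarrow> real \<Rightarrow> 'a measure \<Rightarrow> 'a measure \<Rightarrow> ennreal" where
  "wasserstein N p \<mu> \<nu> =
     (INF \<pi>\<in>couplings \<mu> \<nu>.
        ennreal_powr (\<integral>\<^sup>+(x, y). ennreal (N (x - y) powr p) \<partial>\<pi>) (1 / p))"

(* cbox x y is the product of the intervals [x$i, y$i], and is empty unless x$i \<le> y$i for all i. *)
definition unif_discrepancy ::
  "(real ^ 'n) measure \<Rightarrow> (real ^ 'n) measure \<Rightarrow> real" where
  "unif_discrepancy \<mu> \<nu> =
     (SUP (x, y)\<in>UNIV. \<bar>measure \<mu> (cbox x y) - measure \<nu> (cbox x y)\<bar>)"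

definition moment :: "('a \<Rightarrow> real) \<Rightarrow> 'a measure \<Rightarrow> real \<Rightarrow> ennreal" where
  "moment N \<mu> q = (\<integral>\<^sup>+x. ennreal (N x powr q) \<partial>\<mu>)"

(* The sum \<mu> + \<nu>; meaningful for measures on the same sigma-algebra. *)
definition measure_sum :: "'a measure \<Rightarrow> 'a measure \<Rightarrow> 'a measure" where
  "measure_sum \<mu> \<nu> = measure_of (space \<mu>) (sets \<mu>) (\<lambda>A. emeasure \<mu> A + emeasure \<nu> A)"

lemma space_measure_sum [simp]: "space (measure_sum \<mu> \<nu>) = space \<mu>"
  by (simp add: measure_sum_def)

lemma sets_measure_sum [simp, measurable_cong]: "sets (measure_sum \<mu> \<nu>) = sets \<mu>"
  by (simp add: measure_sum_def)

lemma emeasure_measure_sum: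
  assumes "sets \<nu> = sets \<mu>"
  shows "emeasure (measure_sum \<mu> \<nu>) A = emeasure \<mu> A + emeasure \<nu> A"
proof (cases "A \<in> sets \<mu>")
  case True
  show ?thesis unfolding measure_sum_def
  proof (rule emeasure_measure_of_sigma)
    show "sigma_algebra (space \<mu>) (sets \<mu>)" by (rule sets.sigma_algebra_axioms)
    show "positive (sets \<mu>) (\<lambda>A. emeasure \<mu> A + emeasure \<nu> A)"
      by (simp add: positive_def)
    show "countably_additive (sets \<mu>) (\<lambda>A. emeasure \<mu> A + emeasure \<nu> A)"
    proof (rule countably_additiveI)
      fix F :: "nat \<Rightarrow> 'a set"
      assume F: "range F \<subseteq> sets \<mu>" "disjoint_family F"
      have "(\<Sum>i. emeasure \<mu> (F i) + emeasure \<nu> (F i)) =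
          (\<Sum>i. emeasure \<mu> (F i)) + (\<Sum>i. emeasure \<nu> (F i))"
        by (intro suminf_add [symmetric]) auto
      also have "\<dots> = emeasure \<mu> (\<Union>i. F i) + emeasure \<nu> (\<Union>i. F i)"
        using F assms by (simp add: suminf_emeasure)
      finally show "(\<Sum>i. emeasure \<mu> (F i) + emeasure \<nu> (F i)) =
          emeasure \<mu> (\<Union>i. F i) + emeasure \<nu> (\<Union>i. F i)" .
    qed
  qed (rule True)
next
  case False
  then show ?thesis using assms by (simp add: emeasure_notin_sets)
qed

end

theory Submission
  imports Defs
begin

text \<open>Space is cut into the dyadic shells \<open>n\<close> (differences of the cubes \<open>[-2^n, 2^n)\<close>), and the
  shell \<open>n\<close> is cut at level \<open>l\<close> by the grid of mesh \<open>2^(n - l)\<close>. For finitely many levels there is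
  a coupling that keeps in every cell \<open>F\<close> the largest possible mass \<open>min (\<mu> F) (\<nu> F)\<close>, so that the
  mass leaving \<open>F\<close> is at most \<open>\<bar>\<mu> F - \<nu> F\<bar>\<close>. Its cost is bounded, up to a constant and an error
  that vanishes as the number of levels grows, by the sum over \<open>n\<close>, \<open>l\<close> and the cells \<open>F\<close> of
  \<open>2^(p (n - l)) \<bar>\<mu> F - \<nu> F\<bar>\<close>. Cells are differences of two half-open boxes, so for fixed
  \<open>n\<close> and \<open>l\<close> the sum over \<open>F\<close> is \<open>O(2^(d l) D)\<close>, where \<open>D\<close> is the discrepancy; by Markov's
  inequality it is also \<open>O(M 2^(- q n))\<close>, where \<open>M\<close> is the moment. It remains to sum
  \<open>2^(p (n - l)) min (2^(d l) D) (2^(- q n))\<close> over \<open>n\<close> and \<open>l\<close>.\<close>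

section \<open>Couplings adapted to nested partitions\<close>

text \<open>Serves the final theorem, where it shows the moment of the averaged measure to be
  finite.\<close>

lemma nn_integral_measure_sum:
  assumes [measurable_cong]: "sets \<nu> = sets \<mu>" and f: "f \<in> borel_measurable \<mu>"
  shows "(\<integral>\<^sup>+x. f x \<partial>measure_sum \<mu> \<nu>) = (\<integral>\<^sup>+x. f x \<partial>\<mu>) + (\<integral>\<^sup>+x. f x \<partial>\<nu>)"
  using f
proof (induction rule: borel_measurable_induct)
  case (cong f g)
  have "(\<integral>\<^sup>+x. f x \<partial>\<mu>) = (\<integral>\<^sup>+x. g x \<partial>\<mu>)" "(\<integral>\<^sup>+x. f x \<partial>\<nu>) = (\<integral>\<^sup>+x. g x \<partial>\<nu>)"
    "(\<integral>\<^sup>+x. f x \<partial>measure_sum \<mu> \<nu>) = (\<integral>\<^sup>+x. g x \<partial>measure_sum \<mu> \<nu>)"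
    using cong(3) sets_eq_imp_space_eq[OF assms(1)] by (auto intro!: nn_integral_cong)
  with cong show ?case by simp
next
  case (set A)
  then show ?case using assms by (simp add: emeasure_measure_sum)
next
  case (mult u c)
  then have [measurable]: "u \<in> borel_measurable \<mu>" by simp
  show ?case using mult by (simp add: nn_integral_cmult distrib_left)
next
  case (add u v)
  then have [measurable]: "u \<in> borel_measurable \<mu>" "v \<in> borel_measurable \<mu>" by simp_all
  show ?case using add by (simp add: nn_integral_add ac_simps)
next
  case (seq U)
  then have [measurable]: "\<And>i. U i \<in> borel_measurable \<mu>" by simp
  have "incseq (\<lambda>i. integral\<^sup>N \<mu> (U i))" "incseq (\<lambda>i. integral\<^sup>N \<nu> (U i))"
    using \<open>incseq U\<close> by (auto simp: incseq_def le_fun_def intro!: nn_integral_mono)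
  then show ?case using seq
    by (simp add: SUP_apply[abs_def] nn_integral_monotone_convergence_SUP ennreal_SUP_add)
qed

text \<open>On each cell of the partition \<open>f\<close> this is the product measure, rescaled to mass
  \<open>min a b\<close> where \<open>a\<close> and \<open>b\<close> are the masses of the cell, because
  \<open>min a b / (a * b) = 1 / max a b\<close>. Cells with \<open>a = b = 0\<close> are null sets, so the
  value \<open>1 / 0 = \<top>\<close> of the density does no harm.\<close>

definition overlap :: "'a measure \<Rightarrow> 'a measure \<Rightarrow> ('a \<Rightarrow> 'c) \<Rightarrow> ('a \<times> 'a) measure" where
  "overlap \<mu> \<nu> f = density (\<mu> \<Otimes>\<^sub>M \<nu>) (\<lambda>(x, y).
     if f x = f y
     then 1 / max (emeasure \<mu> (f -` {f x} \<inter> space \<mu>)) (emeasure \<nu> (f -` {f x} \<inter> space \<mu>))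
     else 0)"

text \<open>Finite measures instead of probability measures, because the construction is iterated on
  what finer levels leave unmatched.\<close>

locale partitioned_measures =
  fixes \<mu> \<nu> :: "'a measure" and f :: "'a \<Rightarrow> 'c::countable"
  assumes fin: "finite_measure \<mu>" "finite_measure \<nu>"
    and sets_eq [measurable_cong]: "sets \<nu> = sets \<mu>"
    and f [measurable]: "f \<in> measurable \<mu> (count_space UNIV)"
begin

abbreviation "F c \<equiv> f -` {c} \<inter> space \<mu>"

definition g :: "'c \<Rightarrow> ennreal" where
  "g c = 1 / max (emeasure \<mu> (F c)) (emeasure \<nu> (F c))"

lemma space_eq: "space \<nu> = space \<mu>"
  using sets_eq by (rule sets_eq_imp_space_eq)

sublocale \<mu>: finite_measure \<mu> by (rule fin)
sublocale \<nu>: finite_measure \<nu> by (rule fin)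
sublocale \<mu>\<nu>: pair_sigma_finite \<mu> \<nu> ..

lemma F_sets [measurable]: "F c \<in> sets \<mu>" by measurable

lemma F_sets_\<nu> [measurable]: "F c \<in> sets \<nu>" using F_sets sets_eq by simp

lemma g_measurable [measurable]:
  "(\<lambda>x. g (f x)) \<in> borel_measurable \<mu>"
  "(\<lambda>x. emeasure \<mu> (F (f x))) \<in> borel_measurable \<mu>"
  "(\<lambda>x. emeasure \<nu> (F (f x))) \<in> borel_measurable \<mu>"
  by (rule measurable_compose[OF f]; simp)+

lemma overlap_eq:
  "overlap \<mu> \<nu> f = density (\<mu> \<Otimes>\<^sub>M \<nu>) (\<lambda>(x, y). if f x = f y then g (f x) else 0)"
  unfolding overlap_def g_def by (intro arg_cong[where f="density _"] ext) auto

text \<open>Tonelli in both orders, one for each marginal. The density vanishes unless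
  \<open>f x = f y\<close>, so its value can be written with either point.\<close>

lemma emeasure_overlap:
  assumes [measurable]: "A \<in> sets \<mu>" "B \<in> sets \<mu>"
  shows "emeasure (overlap \<mu> \<nu> f) (A \<times> B)
      = (\<integral>\<^sup>+x. emeasure \<nu> (B \<inter> F (f x)) * g (f x) * indicator A x \<partial>\<mu>)"
    and "emeasure (overlap \<mu> \<nu> f) (A \<times> B)
      = (\<integral>\<^sup>+y. emeasure \<mu> (A \<inter> F (f y)) * g (f y) * indicator B y \<partial>\<nu>)"
proof -
  let ?k = "\<lambda>(x, y). (if f x = f y then g (f x) else 0) * indicator (A \<times> B) (x, y)"
  have [measurable]: "B \<in> sets \<nu>" using sets_eq assms by simp
  have [measurable]: "A \<times> B \<in> sets (\<mu> \<Otimes>\<^sub>M \<nu>)" by measurable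
  have "(\<lambda>z. g (f (fst z))) \<in> borel_measurable (\<mu> \<Otimes>\<^sub>M \<nu>)"
    by (rule measurable_compose[OF measurable_fst g_measurable(1)])
  then have k [measurable]: "?k \<in> borel_measurable (\<mu> \<Otimes>\<^sub>M \<nu>)"
    "(\<lambda>(x, y). if f x = f y then g (f x) else 0) \<in> borel_measurable (\<mu> \<Otimes>\<^sub>M \<nu>)"
    by (simp_all add: split_beta' pred_def)
  have *: "emeasure (overlap \<mu> \<nu> f) (A \<times> B) = (\<integral>\<^sup>+z. ?k z \<partial>(\<mu> \<Otimes>\<^sub>M \<nu>))"
    unfolding overlap_eq by (subst emeasure_density) (auto intro!: nn_integral_cong)
  also have "\<dots> = (\<integral>\<^sup>+x. \<integral>\<^sup>+y. ?k (x, y) \<partial>\<nu> \<partial>\<mu>)"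
    by (rule \<nu>.nn_integral_fst[OF k(1), symmetric])
  also have "\<dots> = (\<integral>\<^sup>+x. \<integral>\<^sup>+y. g (f x) * indicator A x * indicator (B \<inter> F (f x)) y \<partial>\<nu> \<partial>\<mu>)"
    by (intro nn_integral_cong) (auto simp: space_eq split: split_indicator)
  also have "\<dots> = (\<integral>\<^sup>+x. emeasure \<nu> (B \<inter> F (f x)) * g (f x) * indicator A x \<partial>\<mu>)"
    by (intro nn_integral_cong, subst nn_integral_cmult_indicator)
      (simp_all add: mult.assoc mult.commute mult.left_commute)
  finally show "emeasure (overlap \<mu> \<nu> f) (A \<times> B)
      = (\<integral>\<^sup>+x. emeasure \<nu> (B \<inter> F (f x)) * g (f x) * indicator A x \<partial>\<mu>)" .
  have "(\<integral>\<^sup>+z. ?k z \<partial>(\<mu> \<Otimes>\<^sub>M \<nu>)) = (\<integral>\<^sup>+y. \<integral>\<^sup>+x. ?k (x, y) \<partial>\<mu> \<partial>\<nu>)"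
    by (rule \<mu>\<nu>.nn_integral_snd[symmetric]) (use k in \<open>simp add: split_beta'\<close>)
  also have "\<dots> = (\<integral>\<^sup>+y. \<integral>\<^sup>+x. g (f y) * indicator B y * indicator (A \<inter> F (f y)) x \<partial>\<mu> \<partial>\<nu>)"
    by (intro nn_integral_cong) (auto simp: space_eq split: split_indicator)
  also have "\<dots> = (\<integral>\<^sup>+y. emeasure \<mu> (A \<inter> F (f y)) * g (f y) * indicator B y \<partial>\<nu>)"
    by (intro nn_integral_cong, subst nn_integral_cmult_indicator)
      (simp_all add: mult.assoc mult.commute mult.left_commute)
  finally show "emeasure (overlap \<mu> \<nu> f) (A \<times> B)
      = (\<integral>\<^sup>+y. emeasure \<mu> (A \<inter> F (f y)) * g (f y) * indicator B y \<partial>\<nu>)"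
    using * by simp
qed

text \<open>\<open>h\<close> and \<open>h'\<close> are the densities of the marginals of
  \<open>overlap\<close> with respect to \<open>\<mu>\<close> and \<open>\<nu>\<close>: the
  proportion of the mass at a point that is matched inside its cell.\<close>

definition h :: "'a \<Rightarrow> ennreal" where "h x = emeasure \<nu> (F (f x)) * g (f x)"
definition h' :: "'a \<Rightarrow> ennreal" where "h' x = emeasure \<mu> (F (f x)) * g (f x)"

lemma h_measurable [measurable]: "h \<in> borel_measurable \<mu>" "h' \<in> borel_measurable \<mu>"
  unfolding h_def[abs_def] h'_def[abs_def] by measurable

text \<open>In \<open>ennreal\<close> the product \<open>x * (1 / x)\<close> is 1 for finite
  positive \<open>x\<close> and 0 at both 0 and \<open>\<top>\<close>, so it never exceeds
  1.\<close>

lemma divide_max_le_1: "(a::ennreal) * (1 / max a b) \<le> 1" "b * (1 / max a b) \<le> 1"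
proof -
  have *: "x * (1 / x) \<le> 1" for x :: ennreal
  proof (cases "x = 0 \<or> x = \<top>")
    case False
    then show ?thesis by (simp add: ennreal_times_divide ennreal_divide_self top.not_eq_extremum)
  qed auto
  show "a * (1 / max a b) \<le> 1"
    by (rule order_trans[OF _ *[of "max a b"]]) (intro mult_right_mono; simp)
  show "b * (1 / max a b) \<le> 1"
    by (rule order_trans[OF _ *[of "max a b"]]) (intro mult_right_mono; simp)
qed

lemma h_le_1: "h x \<le> 1" "h' x \<le> 1"
  unfolding h_def h'_def g_def by (rule divide_max_le_1)+

text \<open>\<open>\<alpha>\<close> and \<open>\<beta>\<close> are the unmatched parts. Subtraction
  in \<open>ennreal\<close> is truncated, but \<open>h_le_1\<close> makes it exact here.\<close>

definition \<alpha> :: "'a measure" where "\<alpha> = density \<mu> (\<lambda>x. 1 - h x)"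
definition \<beta> :: "'a measure" where "\<beta> = density \<nu> (\<lambda>x. 1 - h' x)"

lemma rest_emeasure:
  assumes [measurable]: "A \<in> sets \<mu>"
  shows "(\<integral>\<^sup>+x. h x * indicator A x \<partial>\<mu>) + emeasure \<alpha> A = emeasure \<mu> A"
    and "(\<integral>\<^sup>+x. h' x * indicator A x \<partial>\<nu>) + emeasure \<beta> A = emeasure \<nu> A"
proof -
  have [measurable]: "A \<in> sets \<nu>" using sets_eq assms by simp
  have [simp]: "h x * indicator A x + (1 - h x) * indicator A x = indicator A x"
     "h' x * indicator A x + (1 - h' x) * indicator A x = indicator A x" for x
    using h_le_1[of x] by (auto split: split_indicator simp: add_diff_inverse_ennreal)
  show "(\<integral>\<^sup>+x. h x * indicator A x \<partial>\<mu>) + emeasure \<alpha> A = emeasure \<mu> A"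
    unfolding \<alpha>_def by (simp add: emeasure_density nn_integral_add[symmetric])
  show "(\<integral>\<^sup>+x. h' x * indicator A x \<partial>\<nu>) + emeasure \<beta> A = emeasure \<nu> A"
    unfolding \<beta>_def by (simp add: emeasure_density nn_integral_add[symmetric])
qed

lemma overlap_marginal:
  assumes "A \<in> sets \<mu>"
  shows "emeasure (overlap \<mu> \<nu> f) (A \<times> space \<mu>) + emeasure \<alpha> A = emeasure \<mu> A"
    and "emeasure (overlap \<mu> \<nu> f) (space \<mu> \<times> A) + emeasure \<beta> A = emeasure \<nu> A"
proof -
  have *: "space \<mu> \<inter> F c = F c" for c by auto
  show "emeasure (overlap \<mu> \<nu> f) (A \<times> space \<mu>) + emeasure \<alpha> A = emeasure \<mu> A"
    using emeasure_overlap(1)[OF assms sets.top] rest_emeasure(1)[OF assms]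
    by (simp add: * h_def)
  show "emeasure (overlap \<mu> \<nu> f) (space \<mu> \<times> A) + emeasure \<beta> A = emeasure \<nu> A"
    using emeasure_overlap(2)[OF sets.top assms] rest_emeasure(2)[OF assms]
    by (simp add: * h'_def)
qed

text \<open>When \<open>A\<close> is a union of cells, mass matched from \<open>A\<close> also ends
  in \<open>A\<close>, so both measures exceed their unmatched parts on \<open>A\<close> by the same
  amount, which can be pulled out of the minimum. Hence an optimal matching of the remainders on
  \<open>A\<close> completes the overlap to an optimal one.\<close>

lemma overlap_square:
  assumes A: "A \<in> sets \<mu>" and sat: "\<And>x. x \<in> A \<Longrightarrow> F (f x) \<subseteq> A"
  shows "emeasure (overlap \<mu> \<nu> f) (A \<times> A) + min (emeasure \<alpha> A) (emeasure \<beta> A)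
    = min (emeasure \<mu> A) (emeasure \<nu> A)"
proof -
  have *: "A \<inter> F (f x) = F (f x)" if "x \<in> A" for x using sat[OF that] by auto
  have "emeasure (overlap \<mu> \<nu> f) (A \<times> A) = (\<integral>\<^sup>+x. h x * indicator A x \<partial>\<mu>)"
    unfolding emeasure_overlap(1)[OF A A] h_def
    by (intro nn_integral_cong) (use * in \<open>simp split: split_indicator\<close>)
  moreover have "emeasure (overlap \<mu> \<nu> f) (A \<times> A) = (\<integral>\<^sup>+x. h' x * indicator A x \<partial>\<nu>)"
    unfolding emeasure_overlap(2)[OF A A] h'_def
    by (intro nn_integral_cong) (use * in \<open>simp split: split_indicator\<close>)
  ultimately show ?thesis
    unfolding rest_emeasure(1)[OF A, symmetric] rest_emeasure(2)[OF A, symmetric]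
    by (cases "emeasure \<alpha> A" "emeasure \<beta> A" rule: linorder_le_cases)
      (simp_all add: min.absorb1 min.absorb2 add_left_mono)
qed

lemma overlap_cell:
  "emeasure (overlap \<mu> \<nu> f) (F c \<times> F c) = min (emeasure \<mu> (F c)) (emeasure \<nu> (F c))"
proof -
  let ?a = "emeasure \<mu> (F c)" and ?b = "emeasure \<nu> (F c)"
  have "emeasure (overlap \<mu> \<nu> f) (F c \<times> F c) = (\<integral>\<^sup>+x. (?b * g c) * indicator (F c) x \<partial>\<mu>)"
    unfolding emeasure_overlap(1)[OF F_sets F_sets]
    by (intro nn_integral_cong) (auto split: split_indicator)
  also have "\<dots> = ?b * g c * ?a" by (subst nn_integral_cmult_indicator) auto
  \<comment> \<open>A product of two numbers is the product of their minimum and their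
    maximum.\<close>
  also have "\<dots> = min ?a ?b * (max ?a ?b * (1 / max ?a ?b))"
    unfolding g_def by (auto simp: min_def max_def ac_simps)
  also have "\<dots> = min ?a ?b"
  proof (cases "max ?a ?b = 0")
    case True
    then show ?thesis by (simp add: max_def split: if_splits)
  next
    case False
    moreover have "max ?a ?b < \<top>"
      by (simp add: max_def \<mu>.emeasure_eq_measure \<nu>.emeasure_eq_measure)
    ultimately show ?thesis by (simp add: ennreal_times_divide ennreal_divide_self)
  qed
  finally show ?thesis .
qed

end

text \<open>Mass is matched greedily, the finest partition first; no cell of it is then
  charged by both unmatched parts, and these are treated by the coarser partitions.\<close>

lemma nested_partitions_subcoupling:
  fixes f :: "nat \<Rightarrow> 'a \<Rightarrow> 'c::countable"
  assumes f_meas: "\<And>l. f l \<in> measurable M (count_space UNIV)"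
    and nested: "\<And>l x y. f (Suc l) x = f (Suc l) y \<Longrightarrow> f l x = f l y"
    and "finite_measure \<mu>" "finite_measure \<nu>" "sets \<mu> = sets M" "sets \<nu> = sets M"
  shows "\<exists>\<pi>. sets \<pi> = sets (M \<Otimes>\<^sub>M M) \<and>
    (\<forall>A\<in>sets M. emeasure \<pi> (A \<times> space M) \<le> emeasure \<mu> A \<and>
       emeasure \<pi> (space M \<times> A) \<le> emeasure \<nu> A) \<and>
    (\<forall>l<k. \<forall>c. emeasure \<pi> ((f l -` {c} \<inter> space M) \<times> (f l -` {c} \<inter> space M))
       = min (emeasure \<mu> (f l -` {c} \<inter> space M)) (emeasure \<nu> (f l -` {c} \<inter> space M)))"
  using assms(3-)
proof (induction k arbitrary: \<mu> \<nu>)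
  case 0
  show ?case by (rule exI[of _ "null_measure (M \<Otimes>\<^sub>M M)"]) simp
next
  case (Suc k)
  have sp: "space \<mu> = space M" "space \<nu> = space M"
    using Suc.prems by (auto dest: sets_eq_imp_space_eq)
  interpret partitioned_measures \<mu> \<nu> "f k"
    by (rule partitioned_measures.intro)
      (simp_all add: Suc.prems measurable_cong_sets[OF Suc.prems(3) refl] f_meas)
  have "emeasure \<alpha> (space \<mu>) \<le> emeasure \<mu> (space \<mu>)" "emeasure \<beta> (space \<mu>) \<le> emeasure \<nu> (space \<mu>)"
    by (subst rest_emeasure[OF sets.top, symmetric], simp)+
  then have "finite_measure \<alpha>" "finite_measure \<beta>"
    by (auto intro!: finite_measureI simp: \<alpha>_def \<beta>_def space_eq top_unique)
  moreover have "sets \<alpha> = sets M" "sets \<beta> = sets M"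
    using Suc.prems by (auto simp: \<alpha>_def \<beta>_def)
  ultimately obtain \<pi> where \<pi>: "sets \<pi> = sets (M \<Otimes>\<^sub>M M)"
    "\<And>A. A \<in> sets M \<Longrightarrow> emeasure \<pi> (A \<times> space M) \<le> emeasure \<alpha> A"
    "\<And>A. A \<in> sets M \<Longrightarrow> emeasure \<pi> (space M \<times> A) \<le> emeasure \<beta> A"
    "\<And>l c. l < k \<Longrightarrow> emeasure \<pi> ((f l -` {c} \<inter> space M) \<times> (f l -` {c} \<inter> space M))
       = min (emeasure \<alpha> (f l -` {c} \<inter> space M)) (emeasure \<beta> (f l -` {c} \<inter> space M))"
    using Suc.IH[of \<alpha> \<beta>] by blast
  let ?o = "overlap \<mu> \<nu> (f k)"
  let ?\<pi> = "measure_sum ?o \<pi>"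
  have so: "sets ?o = sets (M \<Otimes>\<^sub>M M)"
    unfolding overlap_def using Suc.prems by (simp cong: sets_pair_measure_cong)
  have em: "emeasure ?\<pi> A = emeasure ?o A + emeasure \<pi> A" for A
    using \<pi>(1) so by (simp add: emeasure_measure_sum)
  have marg: "emeasure ?\<pi> (A \<times> space M) \<le> emeasure \<mu> A"
    "emeasure ?\<pi> (space M \<times> A) \<le> emeasure \<nu> A" if "A \<in> sets M" for A
    using overlap_marginal[of A, symmetric] \<pi>(2,3)[of A] that Suc.prems unfolding em sp
    by (simp_all add: add_left_mono)
  have mono: "f l x = f l y" if "l \<le> m" "f m x = f m y" for l m x y
    using that by (induction rule: dec_induct) (auto dest: nested)
  have square: "emeasure ?\<pi> (G \<times> G) = min (emeasure \<mu> G) (emeasure \<nu> G)"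
    if l: "l < Suc k" and G: "G = f l -` {c} \<inter> space M" for l c G
  proof (cases "l = k")
    case True
    have Gs: "G \<in> sets M" unfolding G using measurable_sets[OF f_meas[of l], of "{c}"] by simp
    then have "G \<times> G \<in> sets (M \<Otimes>\<^sub>M M)" by simp
    \<comment> \<open>The overlap alone attains the minimum on the cells of the finest level, and
      the marginal bounds leave no room for more.\<close>
    have le: "emeasure ?\<pi> (G \<times> G) \<le> emeasure ?\<pi> (G \<times> space M)"
      "emeasure ?\<pi> (G \<times> G) \<le> emeasure ?\<pi> (space M \<times> G)"
      using Gs so sets.sets_into_space[OF Gs] by (auto intro!: emeasure_mono)
    show ?thesis
    proof (rule antisym)
      show "emeasure ?\<pi> (G \<times> G) \<le> min (emeasure \<mu> G) (emeasure \<nu> G)"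
        using le marg[OF Gs] by auto
      show "min (emeasure \<mu> G) (emeasure \<nu> G) \<le> emeasure ?\<pi> (G \<times> G)"
        using overlap_cell[of c] unfolding em G True by (simp add: sp)
    qed
  next
    case False
    then have lk: "l < k" using l by simp
    have Gs: "G \<in> sets \<mu>"
      unfolding G using measurable_sets[OF f_meas[of l], of "{c}"] Suc.prems by simp
    \<comment> \<open>Cells of a level \<open>l < k\<close> are unions of cells of level
      \<open>k\<close>, as \<open>overlap_square\<close> requires.\<close>
    have "f k -` {f k x} \<inter> space \<mu> \<subseteq> G" if "x \<in> G" for x
    proof
      fix y assume "y \<in> f k -` {f k x} \<inter> space \<mu>"
      then have "f k y = f k x" "y \<in> space M" by (auto simp: sp)
      then show "y \<in> G" using mono[OF less_imp_le[OF lk], of y x] that by (simp add: G)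
    qed
    from overlap_square[OF Gs this] show ?thesis
      using \<pi>(4)[OF lk, of c] unfolding em G by simp
  qed
  show ?case
  proof (intro exI[of _ ?\<pi>] conjI ballI allI impI)
    show "sets ?\<pi> = sets (M \<Otimes>\<^sub>M M)" using so by simp
  qed (fact marg square[OF _ refl])+
qed

text \<open>A trivial partition with one cell, put in front as the coarsest level, forces the total
  mass \<open>min 1 1 = 1\<close>. Marginals that are dominated by probability measures and have
  mass 1 are equal to them.\<close>

lemma nested_partitions_coupling:
  fixes f :: "nat \<Rightarrow> 'a \<Rightarrow> 'c::countable"
  assumes f: "\<And>l. f l \<in> measurable M (count_space UNIV)"
    and nested: "\<And>l x y. f (Suc l) x = f (Suc l) y \<Longrightarrow> f l x = f l y"
    and "prob_space \<mu>" "prob_space \<nu>" and sets: "sets \<mu> = sets M" "sets \<nu> = sets M"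
  shows "\<exists>\<pi>\<in>couplings \<mu> \<nu>. \<forall>l<k. \<forall>c.
    emeasure \<pi> ((f l -` {c} \<inter> space M) \<times> (f l -` {c} \<inter> space M))
       = min (emeasure \<mu> (f l -` {c} \<inter> space M)) (emeasure \<nu> (f l -` {c} \<inter> space M))"
proof -
  interpret \<mu>: prob_space \<mu> by fact
  interpret \<nu>: prob_space \<nu> by fact
  have sp: "space \<mu> = space M" "space \<nu> = space M"
    using sets by (auto dest: sets_eq_imp_space_eq)
  \<comment> \<open>Level 0 has the single label \<open>None\<close>; the original levels move up by
    one, which is why \<open>Suc k\<close> levels are requested below.\<close>
  define f' where "f' l = (case l of 0 \<Rightarrow> (\<lambda>_. None) | Suc l \<Rightarrow> (\<lambda>x. Some (f l x)))" for l
  have "f' l \<in> measurable M (count_space UNIV)" for l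
    unfolding f'_def using measurable_compose[OF f, of Some "count_space UNIV"]
    by (auto split: nat.split)
  moreover have "f' l x = f' l y" if "f' (Suc l) x = f' (Suc l) y" for l x y
    using that by (cases l) (auto simp: f'_def intro: nested)
  ultimately obtain \<pi> where \<pi>: "sets \<pi> = sets (M \<Otimes>\<^sub>M M)"
    "\<And>A. A \<in> sets M \<Longrightarrow> emeasure \<pi> (A \<times> space M) \<le> emeasure \<mu> A"
    "\<And>A. A \<in> sets M \<Longrightarrow> emeasure \<pi> (space M \<times> A) \<le> emeasure \<nu> A"
    "\<And>l c. l < Suc k \<Longrightarrow> emeasure \<pi> ((f' l -` {c} \<inter> space M) \<times> (f' l -` {c} \<inter> space M))
       = min (emeasure \<mu> (f' l -` {c} \<inter> space M)) (emeasure \<nu> (f' l -` {c} \<inter> space M))"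
    using nested_partitions_subcoupling[of f' M \<mu> \<nu> "Suc k"] sets
      \<mu>.finite_measure_axioms \<nu>.finite_measure_axioms by blast
  have sp\<pi>: "space \<pi> = space M \<times> space M"
    using \<pi>(1) by (auto dest: sets_eq_imp_space_eq simp: space_pair_measure)
  have "emeasure \<pi> (space M \<times> space M) = 1"
    using \<pi>(4)[of 0 None] \<mu>.emeasure_space_1 \<nu>.emeasure_space_1 by (simp add: f'_def sp)
  then interpret \<pi>: prob_space \<pi> by (intro prob_spaceI) (simp add: sp\<pi>)
  \<comment> \<open>\<open>T A\<close> stands for \<open>A \<times> space M\<close> or
    \<open>space M \<times> A\<close>. Domination on a set and on its complement, with equal totals,
    gives equality.\<close>
  have eq: "emeasure \<pi> (T A) = emeasure \<rho> A"
    if \<rho>: "prob_space \<rho>" "sets \<rho> = sets M"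
      and T: "\<And>A. A \<in> sets M \<Longrightarrow> T A \<in> sets \<pi>" "\<And>A. A \<in> sets M \<Longrightarrow> T (space M - A) = space \<pi> - T A"
      and le: "\<And>A. A \<in> sets M \<Longrightarrow> emeasure \<pi> (T A) \<le> emeasure \<rho> A" and A: "A \<in> sets M" for T \<rho> A
  proof -
    interpret \<rho>: prob_space \<rho> by fact
    have [simp]: "space \<rho> = space M" using \<rho>(2) by (rule sets_eq_imp_space_eq)
    have "measure \<pi> (T A) \<le> measure \<rho> A"
      using le[OF A] by (simp add: \<pi>.emeasure_eq_measure \<rho>.emeasure_eq_measure)
    moreover have "measure \<pi> (T (space M - A)) \<le> measure \<rho> (space M - A)"
      using le[of "space M - A"] A by (simp add: \<pi>.emeasure_eq_measure \<rho>.emeasure_eq_measure)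
    ultimately have "measure \<pi> (T A) = measure \<rho> A"
      using A T \<rho>.prob_compl[of A] \<pi>.prob_compl[of "T A"] \<rho>(2) by simp
    then show ?thesis by (simp add: \<pi>.emeasure_eq_measure \<rho>.emeasure_eq_measure)
  qed
  have [measurable]: "fst \<in> measurable \<pi> \<mu>" "snd \<in> measurable \<pi> \<nu>"
    unfolding measurable_cong_sets[OF \<pi>(1) sets(1)] measurable_cong_sets[OF \<pi>(1) sets(2)] by simp_all
  have "distr \<pi> \<mu> fst = \<mu>"
  proof (rule measure_eqI)
    fix A assume "A \<in> sets (distr \<pi> \<mu> fst)"
    then have A: "A \<in> sets M" using sets by simp
    have "fst -` A \<inter> space \<pi> = A \<times> space M" using sets.sets_into_space[OF A] by (auto simp: sp\<pi>)
    moreover have "emeasure \<pi> (A \<times> space M) = emeasure \<mu> A"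
      by (rule eq[of "\<mu>" "\<lambda>A. A \<times> space M"]) (use \<pi>(1,2) A sets(1) assms(3) in \<open>auto simp: sp\<pi>\<close>)
    ultimately show "emeasure (distr \<pi> \<mu> fst) A = emeasure \<mu> A"
      using A sets by (simp add: emeasure_distr)
  qed simp
  moreover have "distr \<pi> \<nu> snd = \<nu>"
  proof (rule measure_eqI)
    fix A assume "A \<in> sets (distr \<pi> \<nu> snd)"
    then have A: "A \<in> sets M" using sets by simp
    have "snd -` A \<inter> space \<pi> = space M \<times> A" using sets.sets_into_space[OF A] by (auto simp: sp\<pi>)
    moreover have "emeasure \<pi> (space M \<times> A) = emeasure \<nu> A"
      by (rule eq[of "\<nu>" "\<lambda>A. space M \<times> A"]) (use \<pi>(1,3) A sets(2) assms(4) in \<open>auto simp: sp\<pi>\<close>)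
    ultimately show "emeasure (distr \<pi> \<nu> snd) A = emeasure \<nu> A"
      using A sets by (simp add: emeasure_distr)
  qed simp
  ultimately have "\<pi> \<in> couplings \<mu> \<nu>"
    using \<pi>(1) sets \<pi>.prob_space_axioms by (simp add: couplings_def cong: sets_pair_measure_cong)
  moreover have "emeasure \<pi> ((f l -` {c} \<inter> space M) \<times> (f l -` {c} \<inter> space M))
       = min (emeasure \<mu> (f l -` {c} \<inter> space M)) (emeasure \<nu> (f l -` {c} \<inter> space M))"
    if "l < k" for l c
  proof -
    have "f' (Suc l) -` {Some c} \<inter> space M = f l -` {c} \<inter> space M" by (auto simp: f'_def)
    then show ?thesis using \<pi>(4)[of "Suc l" "Some c"] that by simp
  qed
  ultimately show ?thesis by blast
qed

section \<open>The multiscale double sum\<close>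

text \<open>The terms grow geometrically until \<open>s * r ^ n\<close> passes 1 and decay
  geometrically afterwards. Both halves are controlled by their values near the threshold, so the
  bound does not depend on \<open>s\<close>.\<close>

lemma sum_min_geometric_inverse_le:
  fixes r s :: real
  assumes "1 < r" "0 < s"
  shows "(\<Sum>n<k. min (s * r ^ n) (1 / (s * r ^ n))) \<le> 2 * r / (r - 1)"
proof -
  \<comment> \<open>The uncapped value is what the induction needs; the cap \<open>r\<close> is
    respected because \<open>s * r ^ Suc k\<close> is at most \<open>r\<close> as long as
    \<open>s * r ^ k\<close> is at most 1.\<close>
  have low: "(\<Sum>n<k. if s * r ^ n \<le> 1 then s * r ^ n else 0) \<le> min (s * r ^ k) r / (r - 1)"
  proof (induction k)
    case 0
    then show ?case using assms by simp
  next
    case (Suc k)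
    show ?case
    proof (cases "s * r ^ k \<le> 1")
      case True
      have "(\<Sum>n<k. if s * r ^ n \<le> 1 then s * r ^ n else 0) \<le> s * r ^ k / (r - 1)"
        using Suc assms by (auto simp: min_def divide_simps split: if_splits)
      then have "(\<Sum>n<Suc k. if s * r ^ n \<le> 1 then s * r ^ n else 0) \<le> s * r ^ k / (r - 1) + s * r ^ k"
        using True by simp
      also have "\<dots> = s * r ^ Suc k / (r - 1)" using assms by (simp add: field_simps)
      also have "s * r ^ Suc k \<le> r" using mult_left_mono[OF True, of r] assms by (simp add: ac_simps)
      then have "s * r ^ Suc k / (r - 1) = min (s * r ^ Suc k) r / (r - 1)" by simp
      finally show ?thesis .
    next
      case False
      have "s * r ^ k \<le> s * r ^ Suc k" using assms by simp
      then have "min (s * r ^ k) r / (r - 1) \<le> min (s * r ^ Suc k) r / (r - 1)"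
        using assms by (intro divide_right_mono min.mono) auto
      then show ?thesis using Suc False by simp
    qed
  qed
  \<comment> \<open>Generalised over \<open>s\<close>: when \<open>s\<close> is at most 1 the first
    term vanishes, and the remaining sum is the one for \<open>s * r\<close>.\<close>
  have high: "(\<Sum>n<k. if 1 < s * r ^ n then 1 / (s * r ^ n) else 0) \<le> r / (r - 1)" if "0 < s" for s
    using that
  proof (induction k arbitrary: s)
    case 0
    then show ?case using assms by simp
  next
    case (Suc k)
    show ?case
    proof (cases "1 < s")
      case True
      have "(\<Sum>n<Suc k. if 1 < s * r ^ n then 1 / (s * r ^ n) else 0) \<le> (\<Sum>n<Suc k. (1 / r) ^ n)"
      proof (rule sum_mono)
        fix n
        have "1 / (s * r ^ n) \<le> 1 / (1 * r ^ n)"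
          using True assms by (intro divide_left_mono mult_right_mono) auto
        then show "(if 1 < s * r ^ n then 1 / (s * r ^ n) else 0) \<le> (1 / r) ^ n"
          using assms by (simp add: power_divide)
      qed
      also have "\<dots> \<le> (\<Sum>n. (1 / r) ^ n)"
        using assms by (intro sum_le_suminf) auto
      also have "\<dots> = r / (r - 1)" using assms by (subst suminf_geometric) (auto simp: field_simps)
      finally show ?thesis .
    next
      case False
      have "(\<Sum>n<Suc k. if 1 < s * r ^ n then 1 / (s * r ^ n) else 0)
          = (\<Sum>n<k. if 1 < (s * r) * r ^ n then 1 / ((s * r) * r ^ n) else 0)"
        using False by (subst sum.lessThan_Suc_shift) (simp add: ac_simps cong: if_cong)
      also have "\<dots> \<le> r / (r - 1)" using Suc.prems assms by (intro Suc.IH) simp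
      finally show ?thesis .
    qed
  qed
  have "(\<Sum>n<k. min (s * r ^ n) (1 / (s * r ^ n)))
      \<le> (\<Sum>n<k. (if s * r ^ n \<le> 1 then s * r ^ n else 0) + (if 1 < s * r ^ n then 1 / (s * r ^ n) else 0))"
    by (rule sum_mono) auto
  also have "\<dots> \<le> min (s * r ^ k) r / (r - 1) + r / (r - 1)"
    unfolding sum.distrib using low high[OF \<open>0 < s\<close>] by (rule add_mono)
  also have "\<dots> \<le> r / (r - 1) + r / (r - 1)"
    using assms by (intro add_mono divide_right_mono) auto
  finally show ?thesis by simp
qed

text \<open>The majorant is a product, so the double sum factorises. One index carries plain
  geometric decay, the other two-sided decay; which of shell and level plays which role depends on
  the regime.\<close>

lemma double_sum_geometric_le:
  fixes x r s c :: real
  assumes "0 < x" "x < 1" "1 < r" "0 < s" "0 \<le> c"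
    and T: "\<And>i j. T i j \<le> c * x ^ i * min (s * r ^ j) (1 / (s * r ^ j))"
  shows "(\<Sum>i<a. \<Sum>j<b. T i j) \<le> (1 / (1 - x)) * (2 * r / (r - 1)) * c"
proof -
  have "(\<Sum>i<a. \<Sum>j<b. T i j) \<le> (\<Sum>i<a. \<Sum>j<b. c * x ^ i * min (s * r ^ j) (1 / (s * r ^ j)))"
    by (intro sum_mono T)
  also have "\<dots> = c * ((\<Sum>i<a. x ^ i) * (\<Sum>j<b. min (s * r ^ j) (1 / (s * r ^ j))))"
    by (subst sum_product) (simp add: sum_distrib_left mult.assoc)
  also have "\<dots> \<le> c * ((1 / (1 - x)) * (2 * r / (r - 1)))"
  proof (intro mult_left_mono mult_mono)
    have "(\<Sum>i<a. x ^ i) \<le> (\<Sum>i. x ^ i)" using assms by (intro sum_le_suminf) auto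
    then show "(\<Sum>i<a. x ^ i) \<le> 1 / (1 - x)" using assms by (simp add: suminf_geometric)
  qed (use assms in \<open>auto intro!: sum_min_geometric_inverse_le sum_nonneg\<close>)
  finally show ?thesis by (simp add: ac_simps)
qed

text \<open>Interpolation: the minimum is split into two powers whose exponents add up to 1, and
  each power is estimated by a different argument.\<close>

lemma min_le_powr_mult:
  fixes a b \<theta> :: real
  assumes "0 < a" "0 < b" "0 \<le> \<theta>" "\<theta> \<le> 1"
  shows "min a b \<le> a powr \<theta> * b powr (1 - \<theta>)"
proof -
  have "min a b = min a b powr \<theta> * min a b powr (1 - \<theta>)"
    using assms by (simp flip: powr_add)
  also have "\<dots> \<le> a powr \<theta> * b powr (1 - \<theta>)"
    using assms by (intro mult_mono powr_mono2) auto
  finally show ?thesis .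
qed

lemma min_half:
  fixes a b :: real
  assumes "0 < a" "0 < b"
  shows "0 < min a b / 2" "min a b / 2 < a" "min a b / 2 < b"
  using assms by (auto simp: min_def)

text \<open>At the critical exponent \<open>\<rho>\<close> interpolation of the minimum just fails to be summable;
  using the two exponents \<open>\<rho> + \<delta>\<close> and \<open>\<rho> - \<delta>\<close> at once restores summability.\<close>

lemma multiscale_sum_bound:
  fixes p q d :: real
  assumes "0 < d" "0 < p" "p < q"
    and \<rho>: "p / d < 1 - p / q \<and> \<rho> = p / d \<or> 1 - p / q < p / d \<and> \<rho> = 1 - p / q"
  shows "\<exists>C>0. \<forall>D\<ge>0. \<forall>a b. (\<Sum>n<a. \<Sum>l<b. 2 powr (p * real n - p * real l) *
      min (2 powr (d * real l) * D) (2 powr (- q * real n))) \<le> C * D powr \<rho>"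
proof -
  define T where "T D n l = 2 powr (p * real n - p * real l) *
      min (2 powr (d * real l) * D) (2 powr (- q * real n))" for D and n l :: nat
  \<comment> \<open>The rate in \<open>n\<close> vanishes at \<open>\<theta> = 1 - p / q\<close> and
    the rate in \<open>l\<close> at \<open>\<theta> = p / d\<close>; the regimes differ in which of
    the two is critical at \<open>\<rho>\<close>.\<close>
  have interp: "T D n l \<le> D powr \<theta> * 2 powr ((p - q * (1 - \<theta>)) * n) * 2 powr ((d * \<theta> - p) * l)"
    if "0 < D" "0 \<le> \<theta>" "\<theta> \<le> 1" for D \<theta> n l
  proof -
    have "T D n l \<le> 2 powr (p * real n - p * real l) *
      ((2 powr (d * real l) * D) powr \<theta> * (2 powr (- q * real n)) powr (1 - \<theta>))"
      unfolding T_def using that by (intro mult_left_mono min_le_powr_mult) auto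
    also have "\<dots> = D powr \<theta> * 2 powr ((p - q * (1 - \<theta>)) * n) * 2 powr ((d * \<theta> - p) * l)"
      using that by (simp add: powr_mult powr_powr powr_add[symmetric] algebra_simps)
    finally show ?thesis .
  qed
  \<comment> \<open>Interpolation is available for \<open>D > 0\<close> only; for
    \<open>D = 0\<close> every term vanishes.\<close>
  have T0: "(\<Sum>n<a. \<Sum>l<b. T 0 n l) = 0" for a b unfolding T_def by (simp add: min_def)
  have pow: "2 powr (c * real n) = (2 powr c) ^ n" for c n
    by (simp add: powr_powr[symmetric] powr_realpow)
  from \<rho> show ?thesis
  proof
    assume *: "p / d < 1 - p / q \<and> \<rho> = p / d"
    \<comment> \<open>So small that \<open>\<rho> + \<delta>\<close> stays below
      \<open>1 - p / q\<close> and \<open>\<rho> - \<delta>\<close> stays positive: the sum over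
      \<open>n\<close> still decays at rate \<open>\<eta>\<close>, while the rates in
      \<open>l\<close> are plus and minus \<open>d * \<delta>\<close>.\<close>
    define \<delta> where "\<delta> = min (p / d) (1 - p / q - p / d) / 2"
    have \<delta>: "0 < \<delta>" "\<delta> < p / d" "\<delta> < 1 - p / q - p / d"
      using * divide_pos_pos[OF assms(2,1)] min_half[of "p / d" "1 - p / q - p / d"]
      unfolding \<delta>_def by linarith+
    have pq: "0 < p / q" using assms by simp
    define \<eta> where "\<eta> = q * (1 - \<rho> - \<delta>) - p"
    have "0 < q * (1 - p / q - p / d - \<delta>)" using \<delta> assms by (intro mult_pos_pos) auto
    then have \<eta>: "0 < \<eta>" using * assms unfolding \<eta>_def by (simp add: algebra_simps)
    define x where "x = 2 powr (- \<eta>)"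
    define r where "r = 2 powr (d * \<delta>)"
    have x: "0 < x" "x < 1" unfolding x_def using \<eta> powr_less_mono[of "-\<eta>" 0 2] by auto
    have r: "1 < r" unfolding r_def using \<delta> assms by (intro gr_one_powr) auto
    have le: "T D n l \<le> D powr \<rho> * x ^ n * min (D powr \<delta> * r ^ l) (1 / (D powr \<delta> * r ^ l))"
      if D: "0 < D" for D n l
    proof -
      have 1: "T D n l \<le> D powr \<rho> * x ^ n * (D powr \<delta> * r ^ l)"
      proof -
        have "T D n l \<le> D powr (\<rho> + \<delta>) * 2 powr ((p - q * (1 - (\<rho> + \<delta>))) * n)
            * 2 powr ((d * (\<rho> + \<delta>) - p) * l)"
          using * \<delta> pq by (intro interp D) linarith+
        also have "(p - q * (1 - (\<rho> + \<delta>))) = - \<eta>" by (simp add: \<eta>_def algebra_simps)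
        also have "d * (\<rho> + \<delta>) - p = d * \<delta>" using * assms by (simp add: field_simps)
        finally show ?thesis unfolding x_def r_def pow powr_add by (simp add: ac_simps)
      qed
      have 2: "T D n l \<le> D powr \<rho> * x ^ n * (1 / (D powr \<delta> * r ^ l))"
      proof -
        have "T D n l \<le> D powr (\<rho> - \<delta>) * 2 powr ((p - q * (1 - (\<rho> - \<delta>))) * n)
            * 2 powr ((d * (\<rho> - \<delta>) - p) * l)"
          using * \<delta> pq by (intro interp D) linarith+
        also have "\<dots> \<le> D powr (\<rho> - \<delta>) * 2 powr (- \<eta> * n) * 2 powr ((d * (\<rho> - \<delta>) - p) * l)"
        proof (intro mult_right_mono mult_left_mono powr_mono)
          have "0 \<le> q * \<delta>" using assms \<delta> by simp
          then show "p - q * (1 - (\<rho> - \<delta>)) \<le> - \<eta>" unfolding \<eta>_def by (simp add: algebra_simps)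
        qed auto
        also have "d * (\<rho> - \<delta>) - p = - (d * \<delta>)" using * assms by (simp add: field_simps)
        finally show ?thesis
          unfolding x_def r_def powr_diff pow powr_minus by (simp add: power_inverse divide_simps ac_simps)
      qed
      show ?thesis using 1 2 by (simp add: min_def)
    qed
    have "(\<Sum>n<a. \<Sum>l<b. T D n l) \<le> (1 / (1 - x)) * (2 * r / (r - 1)) * D powr \<rho>"
      if "0 \<le> D" for D a b
    proof (cases "D = 0")
      case False
      then show ?thesis using that x r
        by (intro double_sum_geometric_le[where s="D powr \<delta>"] le) auto
    qed (simp add: T0)
    then show ?thesis using x r unfolding T_def
      by (intro exI[of _ "(1 / (1 - x)) * (2 * r / (r - 1))"]) auto
  next
    assume *: "1 - p / q < p / d \<and> \<rho> = 1 - p / q"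
    \<comment> \<open>Now \<open>n\<close> is the critical index, with rates plus and minus
      \<open>q * \<delta>\<close>, and the levels decay at least at rate \<open>\<eta>\<close>;
      hence the exchange of the two sums at the end.\<close>
    define \<delta> where "\<delta> = min (min \<rho> (1 - \<rho>)) (p / d - \<rho>) / 2"
    have "0 < p / q" "p / q < 1" using assms by auto
    with * have \<rho>': "0 < \<rho>" "\<rho> < 1" by linarith+
    have \<delta>: "0 < \<delta>" "\<delta> < \<rho>" "\<delta> < 1 - \<rho>" "\<delta> < p / d - \<rho>"
      using * \<rho>' min_half[of \<rho> "1 - \<rho>"] min_half[of "min \<rho> (1 - \<rho>)" "p / d - \<rho>"]
      unfolding \<delta>_def by linarith+
    define \<eta> where "\<eta> = p - d * (\<rho> + \<delta>)"
    have \<eta>: "0 < \<eta>" using \<delta> assms unfolding \<eta>_def by (simp add: field_simps)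
    define x where "x = 2 powr (- \<eta>)"
    define r where "r = 2 powr (q * \<delta>)"
    have x: "0 < x" "x < 1" unfolding x_def using \<eta> powr_less_mono[of "-\<eta>" 0 2] by auto
    have r: "1 < r" unfolding r_def using \<delta> assms by (intro gr_one_powr) auto
    have q: "q * \<rho> = q - p" using * assms by (simp add: field_simps)
    have le: "T D n l \<le> D powr \<rho> * x ^ l * min (D powr \<delta> * r ^ n) (1 / (D powr \<delta> * r ^ n))"
      if D: "0 < D" for D n l
    proof -
      have 1: "T D n l \<le> D powr \<rho> * x ^ l * (D powr \<delta> * r ^ n)"
      proof -
        have "T D n l \<le> D powr (\<rho> + \<delta>) * 2 powr ((p - q * (1 - (\<rho> + \<delta>))) * n)
            * 2 powr ((d * (\<rho> + \<delta>) - p) * l)"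
          using \<delta> \<rho>' by (intro interp D) auto
        also have "p - q * (1 - (\<rho> + \<delta>)) = q * \<delta>" using q by (simp add: algebra_simps)
        also have "d * (\<rho> + \<delta>) - p = - \<eta>" by (simp add: \<eta>_def)
        finally show ?thesis unfolding x_def r_def pow powr_add by (simp add: ac_simps)
      qed
      have 2: "T D n l \<le> D powr \<rho> * x ^ l * (1 / (D powr \<delta> * r ^ n))"
      proof -
        have "T D n l \<le> D powr (\<rho> - \<delta>) * 2 powr ((p - q * (1 - (\<rho> - \<delta>))) * n)
            * 2 powr ((d * (\<rho> - \<delta>) - p) * l)"
          using \<delta> \<rho>' by (intro interp D) auto
        also have "\<dots> \<le> D powr (\<rho> - \<delta>) * 2 powr ((p - q * (1 - (\<rho> - \<delta>))) * n) * 2 powr (- \<eta> * l)"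
        proof (intro mult_right_mono mult_left_mono powr_mono)
          have "0 \<le> d * \<delta>" using assms \<delta> by simp
          then show "d * (\<rho> - \<delta>) - p \<le> - \<eta>" unfolding \<eta>_def by (simp add: algebra_simps)
        qed auto
        also have "p - q * (1 - (\<rho> - \<delta>)) = - (q * \<delta>)" using q by (simp add: algebra_simps)
        finally show ?thesis
          unfolding x_def r_def powr_diff pow powr_minus by (simp add: power_inverse divide_simps ac_simps)
      qed
      show ?thesis using 1 2 by (simp add: min_def)
    qed
    have "(\<Sum>n<a. \<Sum>l<b. T D n l) \<le> (1 / (1 - x)) * (2 * r / (r - 1)) * D powr \<rho>"
      if "0 \<le> D" for D a b
    proof (cases "D = 0")
      case False
      then show ?thesis using that x r
        by (subst sum.swap) (intro double_sum_geometric_le[where s="D powr \<delta>"] le, auto)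
    qed (simp add: T0)
    then show ?thesis using x r unfolding T_def
      by (intro exI[of _ "(1 / (1 - x)) * (2 * r / (r - 1))"]) auto
  qed
qed

section \<open>Norms and dyadic cells\<close>

lemma ennreal_powr_mono: "x \<le> y \<Longrightarrow> 0 \<le> a \<Longrightarrow> ennreal_powr x a \<le> ennreal_powr y a"
  by (auto simp: ennreal_powr_def top_unique less_top intro!: ennreal_leI powr_mono2 enn2real_mono)

lemma ennreal_powr_inverse:
  assumes "0 < a"
  shows "ennreal_powr (ennreal_powr x (1 / a)) a = x"
  using assms by (auto simp: ennreal_powr_def powr_powr less_top)

lemma is_normD:
  assumes "is_norm N"
  shows "0 \<le> N x" "N x = 0 \<longleftrightarrow> x = 0" "N (c *\<^sub>R x) = \<bar>c\<bar> * N x" "N (x + y) \<le> N x + N y"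
  using assms unfolding is_norm_def by blast+

lemma is_norm_sum_le:
  assumes "is_norm N" "finite I"
  shows "N (\<Sum>i\<in>I. f i) \<le> (\<Sum>i\<in>I. N (f i))"
  using assms(2)
proof (induction rule: finite_induct)
  case empty
  then show ?case using is_normD(2)[OF assms(1), of 0] by simp
next
  case (insert i I)
  then show ?case using is_normD(4)[OF assms(1), of "f i" "sum f I"] by simp
qed

text \<open>Triangle inequality for the expansion in the standard basis.\<close>

lemma is_norm_le_components:
  fixes N :: "real ^ 'n \<Rightarrow> real"
  assumes N: "is_norm N" and x: "\<And>i. \<bar>x $ i\<bar> \<le> t"
  shows "N x \<le> (\<Sum>i\<in>UNIV. N (axis i 1)) * t"
proof -
  have "N x = N (\<Sum>i\<in>UNIV. x $ i *\<^sub>R axis i 1)"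
    using basis_expansion[of x] by (simp add: scalar_mult_eq_scaleR)
  also have "\<dots> \<le> (\<Sum>i\<in>UNIV. N (x $ i *\<^sub>R axis i 1))"
    using N by (rule is_norm_sum_le) simp
  also have "\<dots> \<le> (\<Sum>i\<in>UNIV. N (axis i 1) * t)"
  proof (rule sum_mono)
    fix i
    have "N (x $ i *\<^sub>R axis i 1) = \<bar>x $ i\<bar> * N (axis i 1)" "0 \<le> N (axis i 1)"
      using is_normD[OF N] by simp_all
    then show "N (x $ i *\<^sub>R axis i 1) \<le> N (axis i 1) * t"
      using mult_right_mono[OF x[of i], of "N (axis i 1)"] by (simp add: mult.commute)
  qed
  finally show ?thesis by (simp add: sum_distrib_right)
qed

lemma is_norm_continuous_on:
  fixes N :: "real ^ 'n \<Rightarrow> real"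
  assumes N: "is_norm N"
  shows "continuous_on UNIV N"
proof -
  let ?K = "\<Sum>i\<in>UNIV. N (axis i 1)"
  have le: "N x - N y \<le> ?K * dist x y" for x y
  proof -
    have "N (x - y + y) \<le> N (x - y) + N y" by (rule is_normD(4)[OF N])
    moreover have "N (x - y) \<le> ?K * dist x y"
      using N by (rule is_norm_le_components) (metis component_le_norm_cart dist_norm)
    ultimately show ?thesis by simp
  qed
  have "?K-lipschitz_on UNIV N"
  proof (rule lipschitz_onI)
    show "dist (N x) (N y) \<le> ?K * dist x y" for x y
      using le[of x y] le[of y x] by (auto simp: dist_real_def dist_commute)
    show "0 \<le> ?K" using is_normD(1)[OF N] by (auto intro: sum_nonneg)
  qed
  then show ?thesis by (rule lipschitz_on_continuous_on)
qed

text \<open>The reverse comparison comes from compactness: \<open>N\<close> attains a positive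
  minimum on the Euclidean unit sphere, and homogeneity carries it over to all vectors.\<close>

lemma is_norm_ge_components:
  fixes N :: "real ^ 'n \<Rightarrow> real"
  assumes N: "is_norm N"
  shows "\<exists>k>0. \<forall>x i. k * \<bar>x $ i\<bar> \<le> N x"
proof -
  have "\<exists>x\<in>sphere (0 :: real ^ 'n) 1. \<forall>y\<in>sphere 0 1. N x \<le> N y"
    by (rule continuous_attains_inf) (auto intro: continuous_on_subset[OF is_norm_continuous_on[OF N]])
  then obtain x0 where x0: "norm x0 = 1" "\<And>y. norm y = 1 \<Longrightarrow> N x0 \<le> N y" by auto
  have "0 < N x0" using is_normD(1,2)[OF N, of x0] x0(1) by (auto simp: less_le)
  moreover have "N x0 * \<bar>x $ i\<bar> \<le> N x" for x i
  proof (cases "x = 0")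
    case False
    have "N x0 \<le> N ((1 / norm x) *\<^sub>R x)" using False by (intro x0(2)) simp
    also have "\<dots> = N x / norm x" using is_normD(3)[OF N] by simp
    finally have "N x0 * norm x \<le> N x" using False by (simp add: field_simps)
    moreover have "N x0 * \<bar>x $ i\<bar> \<le> N x0 * norm x"
      using \<open>0 < N x0\<close> component_le_norm_cart[of x i] by simp
    ultimately show ?thesis by simp
  qed (use is_normD(1)[OF N] in simp)
  ultimately show ?thesis by blast
qed

section \<open>Half-open boxes and the discrepancy\<close>

definition hbox :: "real ^ 'n \<Rightarrow> real ^ 'n \<Rightarrow> (real ^ 'n) set" where
  "hbox a b = {x. \<forall>i. a $ i \<le> x $ i \<and> x $ i < b $ i}"

text \<open>Half-open boxes tile space without overlaps, but the discrepancy sees closed boxes only;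
  an increasing union and continuity of the measures bridge the gap.\<close>

lemma hbox_eq_UN_cbox:
  fixes a b :: "real ^ 'n"
  shows "hbox a b = (\<Union>k. cbox a (\<chi> i. b $ i - 1 / real (Suc k)))"
proof (intro set_eqI iffI)
  fix x assume x: "x \<in> hbox a b"
  \<comment> \<open>The smallest gap to an upper face, positive because there are finitely many
    coordinates.\<close>
  let ?t = "Min (range (\<lambda>i. b $ i - x $ i))"
  have "0 < ?t" using x by (subst Min_gr_iff) (auto simp: hbox_def)
  then obtain k where k: "inverse (real (Suc k)) < ?t" using reals_Archimedean by blast
  have "x $ i \<le> b $ i - 1 / real (Suc k)" for i
  proof -
    have "?t \<le> b $ i - x $ i" by (rule Min_le) auto
    with k have "inverse (real (Suc k)) < b $ i - x $ i" by (rule less_le_trans)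
    then show ?thesis by (simp add: inverse_eq_divide)
  qed
  then show "x \<in> (\<Union>k. cbox a (\<chi> i. b $ i - 1 / real (Suc k)))"
    using x by (auto simp: hbox_def mem_box_cart)
next
  fix x assume "x \<in> (\<Union>k. cbox a (\<chi> i. b $ i - 1 / real (Suc k)))"
  then obtain k where k: "\<And>i. a $ i \<le> x $ i" "\<And>i. x $ i \<le> b $ i - 1 / real (Suc k)"
    by (auto simp: mem_box_cart)
  have "x $ i < b $ i" for i using k(2)[of i] zero_less_divide_1_iff[of "real (Suc k)"] by linarith
  with k(1) show "x \<in> hbox a b" by (simp add: hbox_def)
qed

lemma hbox_borel [measurable]: "hbox a b \<in> sets borel"
  unfolding hbox_eq_UN_cbox by measurable

lemma hbox_Int:
  "hbox a b \<inter> hbox c d = hbox (\<chi> i. max (a $ i) (c $ i)) (\<chi> i. min (b $ i) (d $ i))"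
  by (auto simp: hbox_def)

text \<open>A supremum of reals is known to be an upper bound only when the set is bounded; here 1
  is a bound, as both measures have mass 1.\<close>

lemma unif_discrepancy_upper:
  assumes "prob_space \<mu>" "prob_space \<nu>"
  shows "\<bar>measure \<mu> (cbox x y) - measure \<nu> (cbox x y)\<bar> \<le> unif_discrepancy \<mu> \<nu>"
proof -
  interpret \<mu>: prob_space \<mu> by fact
  interpret \<nu>: prob_space \<nu> by fact
  have "\<bar>measure \<mu> A - measure \<nu> A\<bar> \<le> 1" for A
    using \<mu>.prob_le_1[of A] \<nu>.prob_le_1[of A] measure_nonneg[of \<mu> A] measure_nonneg[of \<nu> A] by linarith
  then have "bdd_above (range (\<lambda>(x, y). \<bar>measure \<mu> (cbox x y) - measure \<nu> (cbox x y)\<bar>))"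
    by (intro bdd_aboveI[of _ 1]) auto
  from cSUP_upper[OF _ this, of "(x, y)"] show ?thesis by (simp add: unif_discrepancy_def)
qed

lemma unif_discrepancy_nonneg:
  assumes "prob_space \<mu>" "prob_space \<nu>"
  shows "0 \<le> unif_discrepancy \<mu> \<nu>"
  using unif_discrepancy_upper[OF assms] abs_ge_zero by (rule order_trans[rotated])

lemma hbox_discrepancy:
  fixes \<mu> \<nu> :: "(real ^ 'n) measure"
  assumes "prob_space \<mu>" "prob_space \<nu>" and sets: "sets \<mu> = sets borel" "sets \<nu> = sets borel"
  shows "\<bar>measure \<mu> (hbox a b) - measure \<nu> (hbox a b)\<bar> \<le> unif_discrepancy \<mu> \<nu>"
proof -
  interpret \<mu>: prob_space \<mu> by fact
  interpret \<nu>: prob_space \<nu> by fact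
  let ?C = "\<lambda>k. cbox a (\<chi> i. b $ i - 1 / real (Suc k))"
  have inc: "incseq ?C"
  proof (rule incseq_SucI)
    fix k
    have "1 / real (Suc (Suc k)) \<le> 1 / real (Suc k)" by (rule divide_left_mono) auto
    then have "t \<le> s - 1 / real (Suc k) \<Longrightarrow> t \<le> s - 1 / real (Suc (Suc k))" for s t :: real
      by linarith
    then show "?C k \<le> ?C (Suc k)"
      by (auto simp: mem_box_cart simp del: of_nat_Suc)
  qed
  have "(\<lambda>k. measure \<mu> (?C k)) \<longlonglongrightarrow> measure \<mu> (hbox a b)"
    unfolding hbox_eq_UN_cbox by (intro \<mu>.finite_Lim_measure_incseq inc) (auto simp: sets)
  moreover have "(\<lambda>k. measure \<nu> (?C k)) \<longlonglongrightarrow> measure \<nu> (hbox a b)"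
    unfolding hbox_eq_UN_cbox by (intro \<nu>.finite_Lim_measure_incseq inc) (auto simp: sets)
  ultimately have "(\<lambda>k. \<bar>measure \<mu> (?C k) - measure \<nu> (?C k)\<bar>)
      \<longlonglongrightarrow> \<bar>measure \<mu> (hbox a b) - measure \<nu> (hbox a b)\<bar>"
    by (intro tendsto_intros)
  then show ?thesis
    by (rule LIMSEQ_le_const2) (use unif_discrepancy_upper[OF assms(1,2)] in blast)
qed

section \<open>Dyadic shells and cells\<close>

definition cube :: "nat \<Rightarrow> (real ^ 'n) set" where
  "cube n = hbox (\<chi> i. - (2 ^ n)) (\<chi> i. 2 ^ n)"

definition shell :: "real ^ 'n \<Rightarrow> nat" where
  "shell x = (LEAST n. x \<in> cube n)"

text \<open>The mesh is proportional to the size of the shell, so the number of cells per shell is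
  bounded in terms of \<open>l\<close> and the dimension alone. The label takes values in a
  countable type, as the abstract coupling requires.\<close>

definition cell :: "nat \<Rightarrow> real ^ 'n \<Rightarrow> nat \<times> (int ^ 'n)" where
  "cell l x = (shell x, \<chi> i. \<lfloor>x $ i * 2 ^ l / 2 ^ shell x\<rfloor>)"

lemma cube_borel [measurable]: "cube n \<in> sets borel"
  by (simp add: cube_def)

lemma cube_mono:
  assumes "m \<le> n"
  shows "cube m \<subseteq> cube n"
proof -
  have "(2::real) ^ m \<le> 2 ^ n" using assms by (rule power_increasing) simp
  then have "- (2 ^ m) \<le> t \<and> t < 2 ^ m \<Longrightarrow> - (2 ^ n) \<le> t \<and> t < 2 ^ n" for t :: real
    by linarith
  then show ?thesis by (auto simp: cube_def hbox_def)
qed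

lemma shell_le_iff: "shell x \<le> n \<longleftrightarrow> x \<in> cube n"
proof
  have "\<exists>n. x \<in> cube n"
  proof -
    obtain n where n: "norm x < 2 ^ n" using real_arch_pow[of 2 "norm x"] by auto
    have "- (2 ^ n) \<le> x $ i \<and> x $ i < 2 ^ n" for i
      using component_le_norm_cart[of x i] n by linarith
    then show ?thesis by (auto simp: cube_def hbox_def)
  qed
  then have "x \<in> cube (shell x)" unfolding shell_def by (rule LeastI_ex)
  then show "shell x \<le> n \<Longrightarrow> x \<in> cube n" using cube_mono by blast
  show "x \<in> cube n \<Longrightarrow> shell x \<le> n" unfolding shell_def by (rule Least_le)
qed

lemma abs_component_le_shell: "\<bar>x $ i\<bar> \<le> 2 ^ shell x"
proof -
  have "x \<in> cube (shell x)" by (simp flip: shell_le_iff)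
  then have "- (2 ^ shell x) \<le> x $ i" "x $ i < 2 ^ shell x" by (auto simp: cube_def hbox_def)
  then show ?thesis by linarith
qed

lemma shell_Suc_component:
  assumes "shell x = Suc n"
  shows "\<exists>i. 2 ^ n \<le> \<bar>x $ i\<bar>"
proof -
  have "x \<notin> cube n" using assms by (simp flip: shell_le_iff)
  then obtain i where "\<not> (- (2 ^ n) \<le> x $ i \<and> x $ i < 2 ^ n)" by (auto simp: cube_def hbox_def)
  then have "2 ^ n \<le> \<bar>x $ i\<bar>" by linarith
  then show ?thesis ..
qed

lemma cell_eq_iff:
  "cell l x = cell l y \<longleftrightarrow> shell x = shell y \<and>
    (\<forall>i. \<lfloor>x $ i * 2 ^ l / 2 ^ shell x\<rfloor> = \<lfloor>y $ i * 2 ^ l / 2 ^ shell y\<rfloor>)"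
  by (auto simp: cell_def vec_eq_iff)

lemma cell_nested:
  assumes "cell (Suc l) x = cell (Suc l) y"
  shows "cell l x = cell l y"
proof -
  \<comment> \<open>Halving the argument of a floor amounts to integer division of the floor by 2,
    so the finer index determines the coarser one.\<close>
  have half: "\<lfloor>t * 2 ^ l / s\<rfloor> = \<lfloor>t * 2 ^ Suc l / s\<rfloor> div 2" for s t :: real
    using floor_divide_real_eq_div[of 2 "t * 2 ^ Suc l / s"] by simp
  show ?thesis using assms unfolding cell_eq_iff half by metis
qed

lemma cell_eq_component_diff:
  assumes "cell l x = cell l y"
  shows "\<bar>x $ i - y $ i\<bar> \<le> 2 ^ shell x / 2 ^ l"
proof -
  let ?s = "2 ^ l / 2 ^ shell x :: real"
  have "shell x = shell y" "\<lfloor>x $ i * 2 ^ l / 2 ^ shell x\<rfloor> = \<lfloor>y $ i * 2 ^ l / 2 ^ shell y\<rfloor>"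
    using assms unfolding cell_eq_iff by blast+
  then have "\<lfloor>x $ i * ?s\<rfloor> = \<lfloor>y $ i * ?s\<rfloor>" by simp
  then have "\<bar>x $ i * ?s - y $ i * ?s\<bar> \<le> 1" by linarith
  also have "x $ i * ?s - y $ i * ?s = (x $ i - y $ i) * ?s" by (rule left_diff_distrib[symmetric])
  also have "\<bar>(x $ i - y $ i) * ?s\<bar> = \<bar>x $ i - y $ i\<bar> * ?s" by (simp only: abs_mult) simp
  finally show ?thesis by (simp add: field_simps)
qed

text \<open>Shell \<open>n\<close> is the difference of two consecutive cubes. The case
  \<open>n = 0\<close> is separate because \<open>n - 1\<close> is then 0 and \<open>cube 0\<close>
  itself would be removed.\<close>

lemma cell_vimage_eq:
  fixes z :: "int ^ 'n"
  shows "cell l -` {(n, z)} = hbox (\<chi> i. z $ i * 2 ^ n / 2 ^ l) (\<chi> i. (z $ i + 1) * 2 ^ n / 2 ^ l) \<inter> cube n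
     - (if n = 0 then {} else cube (n - 1))"
proof (rule set_eqI)
  fix x :: "real ^ 'n"
  have "x \<in> cell l -` {(n, z)} \<longleftrightarrow> shell x = n \<and> (\<forall>i. \<lfloor>x $ i * 2 ^ l / 2 ^ n\<rfloor> = z $ i)"
    by (auto simp: cell_def vec_eq_iff)
  moreover have "shell x = n \<longleftrightarrow> x \<in> cube n \<and> x \<notin> (if n = 0 then {} else cube (n - 1))"
    by (cases n) (auto simp flip: shell_le_iff)
  moreover have "\<lfloor>x $ i * 2 ^ l / 2 ^ n\<rfloor> = z $ i \<longleftrightarrow>
      z $ i * 2 ^ n / 2 ^ l \<le> x $ i \<and> x $ i < (z $ i + 1) * 2 ^ n / 2 ^ l" for i
    by (simp add: floor_eq_iff field_simps)
  ultimately show "x \<in> cell l -` {(n, z)} \<longleftrightarrow> x \<in> hbox (\<chi> i. z $ i * 2 ^ n / 2 ^ l)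
      (\<chi> i. (z $ i + 1) * 2 ^ n / 2 ^ l) \<inter> cube n - (if n = 0 then {} else cube (n - 1))"
    unfolding hbox_def by simp blast
qed

lemma cell_vimage_borel [measurable]: "cell l -` {c} \<in> sets borel"
  by (cases c) (simp add: cell_vimage_eq)

lemma cell_measurable: "cell l \<in> measurable borel (count_space UNIV)"
  by (subst measurable_count_space_eq2_countable) (auto simp: cell_vimage_borel)

lemma shell_measurable [measurable]: "shell \<in> measurable borel (count_space UNIV)"
  using measurable_compose[OF cell_measurable[of 0], of fst "count_space UNIV"]
  by (simp add: cell_def)

text \<open>The mass of a difference of boxes is the mass of a box minus that of an intersection,
  which is again a box; two boxes give the factor 2.\<close>

lemma cell_discrepancy:
  fixes \<mu> \<nu> :: "(real ^ 'n) measure"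
  assumes "prob_space \<mu>" "prob_space \<nu>" and sets: "sets \<mu> = sets borel" "sets \<nu> = sets borel"
  shows "\<bar>measure \<mu> (cell l -` {(n, z)}) - measure \<nu> (cell l -` {(n, z)})\<bar> \<le> 2 * unif_discrepancy \<mu> \<nu>"
proof -
  interpret \<mu>: prob_space \<mu> by fact
  interpret \<nu>: prob_space \<nu> by fact
  note D = hbox_discrepancy[OF assms]
  \<comment> \<open>For \<open>n = 0\<close> the empty hole is written as the degenerate box
    \<open>hbox 0 0\<close>, so that every cell is a difference of two boxes.\<close>
  have hole: "(if n = 0 then {} else cube (n - 1))
      = hbox (if n = 0 then 0 else \<chi> i. - (2 ^ (n - 1))) (if n = 0 then 0 else \<chi> i. 2 ^ (n - 1))"
    by (auto simp: hbox_def cube_def)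
  have "\<exists>a b a' b'. cell l -` {(n, z)} = hbox a b - hbox a' b'"
    unfolding cell_vimage_eq unfolding hole unfolding cube_def hbox_Int by (intro exI, rule refl)
  then obtain a b a' b' where *: "cell l -` {(n, z)} = hbox a b - hbox a' b'" by blast
  have "measure \<mu> (hbox a b - hbox a' b') = measure \<mu> (hbox a b) - measure \<mu> (hbox a b \<inter> hbox a' b')"
    by (rule \<mu>.finite_measure_Diff') (auto simp: sets)
  moreover have "measure \<nu> (hbox a b - hbox a' b') = measure \<nu> (hbox a b) - measure \<nu> (hbox a b \<inter> hbox a' b')"
    by (rule \<nu>.finite_measure_Diff') (auto simp: sets)
  ultimately show ?thesis
    unfolding * using D[of a b] D[of "\<chi> i. max (a $ i) (a' $ i)" "\<chi> i. min (b $ i) (b' $ i)"]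
    by (simp add: hbox_Int)
qed

text \<open>Contains all labels that occur, uniformly in the shell, because coordinates in shell
  \<open>n\<close> lie between \<open>- (2 ^ n)\<close> and \<open>2 ^ n\<close>. Some labels may
  name empty cells, which is harmless in upper bounds.\<close>

definition labels :: "nat \<Rightarrow> (int ^ 'n) set" where
  "labels l = {z. \<forall>i. z $ i \<in> {- (2 ^ l)..<2 ^ l}}"

lemma labels_finite: "finite (labels l :: (int ^ 'n) set)"
  and card_labels_le: "card (labels l :: (int ^ 'n) set) \<le> (2 * 2 ^ l) ^ CARD('n)"
proof -
  let ?P = "PiE (UNIV :: 'n set) (\<lambda>_. {- (2 ^ l)..<2 ^ l :: int})"
  have eq: "(labels l :: (int ^ 'n) set) = vec_lambda ` ?P"
  proof (intro set_eqI iffI)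
    fix z :: "int ^ 'n" assume "z \<in> labels l"
    then have "vec_nth z \<in> ?P" by (auto simp: labels_def)
    then show "z \<in> vec_lambda ` ?P" by (metis image_eqI vec_nth_inverse)
  qed (auto simp: labels_def PiE_iff)
  have "finite ?P" by (rule finite_PiE) auto
  then show "finite (labels l :: (int ^ 'n) set)" using eq by simp
  have "card (labels l :: (int ^ 'n) set) \<le> card ?P"
    unfolding eq using \<open>finite ?P\<close> by (rule card_image_le)
  also have "card ?P = (nat (2 * 2 ^ l)) ^ CARD('n)" by (simp add: card_PiE)
  also have "nat (2 * 2 ^ l) = 2 * 2 ^ l" by (simp add: nat_mult_distrib nat_power_eq)
  finally show "card (labels l :: (int ^ 'n) set) \<le> (2 * 2 ^ l) ^ CARD('n)" .
qed

lemma cell_label: "snd (cell l x) \<in> labels l"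
proof -
  have "- (2 ^ l) \<le> \<lfloor>x $ i * 2 ^ l / 2 ^ shell x\<rfloor> \<and> \<lfloor>x $ i * 2 ^ l / 2 ^ shell x\<rfloor> < 2 ^ l" for i
  proof -
    have "x \<in> cube (shell x)" by (simp flip: shell_le_iff)
    then have *: "- (2 ^ shell x) \<le> x $ i" "x $ i < 2 ^ shell x" by (auto simp: cube_def hbox_def)
    have "- (2 ^ shell x) * 2 ^ l \<le> x $ i * 2 ^ l" "x $ i * 2 ^ l < 2 ^ shell x * 2 ^ l"
      using * by (intro mult_right_mono mult_strict_right_mono; simp)+
    then have "- (2 ^ l) \<le> x $ i * 2 ^ l / 2 ^ shell x" "x $ i * 2 ^ l / 2 ^ shell x < 2 ^ l"
      by (simp_all add: field_simps)
    then show ?thesis by (simp add: le_floor_iff floor_less_iff)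
  qed
  then show ?thesis by (simp add: cell_def labels_def)
qed

text \<open>If \<open>l\<close> is the first level at which \<open>x\<close> and \<open>y\<close> lie in different cells, the distance of the
  two points is at most of the order of the diameter of the cells of that level.\<close>

lemma cell_cost_le:
  fixes N :: "real ^ 'n \<Rightarrow> real"
  assumes N: "is_norm N" and p: "0 < p"
  defines "c \<equiv> (2 * (\<Sum>i\<in>UNIV. N (axis i 1))) powr p"
  defines "w \<equiv> \<lambda>l n. 2 powr (p * real n - p * real l)"
  shows "N (x - y) powr p \<le> c * ((\<Sum>l\<le>L. (w l (shell x) + w l (shell y)) * of_bool (cell l x \<noteq> cell l y))
    + w L (shell x))"
proof -
  let ?K = "\<Sum>i\<in>UNIV. N (axis i 1)"
  let ?S = "\<Sum>l\<le>L. (w l (shell x) + w l (shell y)) * of_bool (cell l x \<noteq> cell l y)"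
  have K: "0 \<le> ?K" using is_normD(1)[OF N] by (auto intro: sum_nonneg)
  have w: "0 \<le> w l n" for l n by (simp add: w_def)
  have S: "0 \<le> ?S" using w by (auto intro!: sum_nonneg)
  have c: "0 \<le> c" by (simp add: c_def)
  \<comment> \<open>The factor 2 covers both uses below: the mesh of the preceding level, which is
    twice as coarse, and at level 0 the side length of a whole cube.\<close>
  have scale: "N (x - y) powr p \<le> c * w l n"
    if "\<And>i. \<bar>x $ i - y $ i\<bar> \<le> 2 * 2 ^ n / 2 ^ l" for l n
  proof -
    have "N (x - y) \<le> ?K * (2 * 2 ^ n / 2 ^ l)"
      using N by (rule is_norm_le_components) (use that in simp)
    then have "N (x - y) powr p \<le> (2 * ?K * (2 ^ n / 2 ^ l)) powr p"
      using is_normD(1)[OF N] p by (intro powr_mono2) (auto simp: ac_simps)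
    also have "\<dots> = c * (2 ^ n / 2 ^ l) powr p"
      using K unfolding c_def by (subst powr_mult) auto
    also have "(2 ^ n / 2 ^ l) powr p = w l n"
      by (simp add: w_def powr_divide powr_diff powr_powr mult.commute flip: powr_realpow)
    finally show ?thesis .
  qed
  show ?thesis
  proof (cases "cell L x = cell L y")
    case True
    \<comment> \<open>Points not separated at level \<open>L\<close> are paid for by the extra term
      \<open>w L (shell x)\<close>.\<close>
    have "\<bar>x $ i - y $ i\<bar> \<le> 2 * 2 ^ shell x / 2 ^ L" for i
      using cell_eq_component_diff[OF True, of i] by (rule order_trans) (simp add: divide_right_mono)
    then have "N (x - y) powr p \<le> c * w L (shell x)" by (rule scale)
    also have "\<dots> \<le> c * (?S + w L (shell x))" using c S by (intro mult_left_mono) auto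
    finally show ?thesis .
  next
    case False
    define l where "l = (LEAST l. cell l x \<noteq> cell l y)"
    have l: "cell l x \<noteq> cell l y" "l \<le> L"
      unfolding l_def using False by (rule LeastI, rule Least_le)
    let ?n = "max (shell x) (shell y)"
    have "\<bar>x $ i - y $ i\<bar> \<le> 2 * 2 ^ ?n / 2 ^ l" for i
    \<comment> \<open>At level 0 the points may lie in different shells, so both are placed in the
      larger cube. At later levels they share the cell of the preceding level and hence the
      shell.\<close>
    proof (cases l)
      case 0
      have "(2::real) ^ shell x \<le> 2 ^ ?n" "(2::real) ^ shell y \<le> 2 ^ ?n"
        by (rule power_increasing; simp)+
      then have "\<bar>x $ i - y $ i\<bar> \<le> 2 * 2 ^ ?n"
        using abs_component_le_shell[of x i] abs_component_le_shell[of y i] by linarith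
      then show ?thesis using 0 by simp
    next
      case (Suc k)
      have *: "cell k x = cell k y" using not_less_Least[of k "\<lambda>l. cell l x \<noteq> cell l y"] Suc unfolding l_def by auto
      then have "shell x = shell y" by (simp add: cell_eq_iff)
      moreover have "\<bar>x $ i - y $ i\<bar> \<le> 2 ^ shell x / 2 ^ k"
        using * by (rule cell_eq_component_diff)
      ultimately show ?thesis using Suc by simp
    qed
    then have "N (x - y) powr p \<le> c * w l ?n" by (rule scale)
    \<comment> \<open>The larger shell belongs to one of the two points, so \<open>w l ?n\<close> is
      one of the two summands.\<close>
    also have "w l ?n \<le> (w l (shell x) + w l (shell y)) * of_bool (cell l x \<noteq> cell l y)"
      using l w by (auto simp: max_def)
    also have "\<dots> \<le> ?S" using l w by (intro member_le_sum) auto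
    also have "\<dots> \<le> ?S + w L (shell x)" using w by simp
    finally show ?thesis using c by (simp add: mult_left_mono)
  qed
qed

section \<open>Bounding the transport cost\<close>

lemma ennreal_half: "(1 / 2 :: ennreal) = ennreal (1 / 2)"
  using divide_ennreal[of 1 2] by simp

text \<open>Markov's inequality. Outside shell 0 a point of shell \<open>n\<close> has a coordinate
  of modulus at least \<open>2 ^ (n - 1)\<close>, which bounds \<open>N\<close> from below; on shell
  0 the total mass 2 suffices because of \<open>1 \<le> m\<close>.\<close>

lemma shell_tail_bound:
  fixes N :: "real ^ 'n \<Rightarrow> real"
  assumes N: "is_norm N" and q: "0 < q"
  shows "\<exists>C>0. \<forall>(\<mu> :: (real ^ 'n) measure) \<nu> m n. prob_space \<mu> \<longrightarrow> prob_space \<nu> \<longrightarrow>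
    sets \<mu> = sets borel \<longrightarrow> sets \<nu> = sets borel \<longrightarrow> 1 \<le> m \<longrightarrow>
    moment N (scale_measure (1 / 2) (measure_sum \<mu> \<nu>)) q \<le> ennreal m \<longrightarrow>
    measure \<mu> (shell -` {n}) + measure \<nu> (shell -` {n}) \<le> C * m * 2 powr (- q * real n)"
proof -
  obtain k where k: "0 < k" "\<And>x i. k * \<bar>x $ i\<bar> \<le> N x"
    using is_norm_ge_components[OF N] by blast
  \<comment> \<open>The entry 2 serves shell 0. In the other entry \<open>2 powr q\<close> makes up
    for \<open>n - 1\<close> in place of \<open>n\<close>, and the factor 2 undoes the averaging of
    the two measures.\<close>
  define C where "C = max 2 (2 * 2 powr q / k powr q)"
  have "measure \<mu> (shell -` {n}) + measure \<nu> (shell -` {n}) \<le> C * m * 2 powr (- q * real n)"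
    if "prob_space \<mu>" "prob_space \<nu>" and [measurable_cong]: "sets \<mu> = sets borel" "sets \<nu> = sets borel"
      and m: "1 \<le> m" "moment N (scale_measure (1 / 2) (measure_sum \<mu> \<nu>)) q \<le> ennreal m"
    for \<mu> \<nu> :: "(real ^ 'n) measure" and m n
  proof -
    interpret \<mu>: prob_space \<mu> by fact
    interpret \<nu>: prob_space \<nu> by fact
    let ?S = "shell -` {n} :: (real ^ 'n) set"
    let ?s = "measure \<mu> ?S + measure \<nu> ?S"
    let ?\<rho> = "scale_measure (1 / 2) (measure_sum \<mu> \<nu>)"
    have S: "?S \<in> sets borel" using measurable_sets[OF shell_measurable, of "{n}"] by simp
    show ?thesis
    proof (cases n)
      case 0
      have "2 * 1 \<le> C * m" using m by (intro mult_mono) (auto simp: C_def)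
      moreover have "?s \<le> 2" using \<mu>.prob_le_1[of ?S] \<nu>.prob_le_1[of ?S] by linarith
      ultimately show ?thesis using 0 by simp
    next
      case (Suc j)
      let ?b = "(k * 2 ^ j) powr q"
      have b: "?b = k powr q * 2 powr (q * real j)"
        using k by (simp add: powr_mult powr_powr mult.commute flip: powr_realpow)
      have e: "2 powr (- q * real n) = inverse (2 powr q * 2 powr (q * real j))"
        unfolding Suc by (simp add: algebra_simps flip: powr_minus powr_add)
      have ge: "?b \<le> N x powr q" if x: "x \<in> ?S" for x
      proof -
        obtain i where "2 ^ j \<le> \<bar>x $ i\<bar>" using shell_Suc_component[of x j] x Suc by auto
        then have "k * 2 ^ j \<le> k * \<bar>x $ i\<bar>" using k(1) by simp
        also have "\<dots> \<le> N x" by (rule k)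
        finally show ?thesis using k(1) q by (intro powr_mono2) auto
      qed
      have "emeasure ?\<rho> ?S = 1 / 2 * (ennreal (measure \<mu> ?S) + ennreal (measure \<nu> ?S))"
        by (simp add: emeasure_measure_sum that \<mu>.emeasure_eq_measure \<nu>.emeasure_eq_measure)
      also have "\<dots> = ennreal (1 / 2 * ?s)"
        unfolding ennreal_half by (subst ennreal_mult) auto
      finally have *: "emeasure ?\<rho> ?S = ennreal (1 / 2 * ?s)" .
      have "ennreal (?b * (?s / 2)) = ennreal ?b * emeasure ?\<rho> ?S"
        unfolding * by (subst ennreal_mult[symmetric]) auto
      also have "\<dots> = (\<integral>\<^sup>+x. ennreal ?b * indicator ?S x \<partial>?\<rho>)"
        using S by (subst nn_integral_cmult_indicator) (auto simp: that)
      also have "\<dots> \<le> moment N ?\<rho> q"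
        unfolding moment_def using ge
        by (intro nn_integral_mono) (auto split: split_indicator intro!: ennreal_leI)
      also note m(2)
      finally have "?b * (?s / 2) \<le> m" using m(1) by simp
      then have "?s \<le> 2 * m / ?b" using k(1) by (simp add: field_simps)
      also have "\<dots> = 2 * 2 powr q / k powr q * m * 2 powr (- q * real n)"
        unfolding b e by (simp add: field_simps)
      also have "\<dots> \<le> C * m * 2 powr (- q * real n)"
        using m by (intro mult_right_mono) (auto simp: C_def)
      finally show ?thesis .
    qed
  qed
  then show ?thesis by (intro exI[of _ C]) (auto simp: C_def)
qed

section \<open>Imbalance of the cells and mismatched pairs\<close>

definition cell_diff :: "(real ^ 'n) measure \<Rightarrow> (real ^ 'n) measure \<Rightarrow> nat \<Rightarrow> nat \<Rightarrow> real" where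
  "cell_diff \<mu> \<nu> l n =
     (\<Sum>z\<in>labels l. \<bar>measure \<mu> (cell l -` {(n, z)}) - measure \<nu> (cell l -` {(n, z)})\<bar>)"

text \<open>The first bound counts labels and applies \<open>cell_discrepancy\<close> to each; the
  second uses that the cells are disjoint subsets of the shell. Together they produce the minimum in
  the multiscale sum.\<close>

lemma cell_diff_le:
  fixes \<mu> \<nu> :: "(real ^ 'n) measure"
  assumes "prob_space \<mu>" "prob_space \<nu>" and sets: "sets \<mu> = sets borel" "sets \<nu> = sets borel"
  shows "cell_diff \<mu> \<nu> l n \<le> 2 * 2 ^ CARD('n) * (2 powr (real CARD('n) * real l) * unif_discrepancy \<mu> \<nu>)"
    and "cell_diff \<mu> \<nu> l n \<le> measure \<mu> (shell -` {n}) + measure \<nu> (shell -` {n})"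
proof -
  let ?D = "unif_discrepancy \<mu> \<nu>"
  let ?c = "\<lambda>z. cell l -` {(n, z)}"
  have D: "0 \<le> ?D" using assms(1,2) by (rule unif_discrepancy_nonneg)
  have "cell_diff \<mu> \<nu> l n \<le> (\<Sum>z\<in>(labels l :: (int ^ 'n) set). 2 * ?D)"
    unfolding cell_diff_def by (intro sum_mono cell_discrepancy assms)
  also have "\<dots> = real (card (labels l :: (int ^ 'n) set)) * (2 * ?D)" by simp
  also have "\<dots> \<le> real ((2 * 2 ^ l) ^ CARD('n)) * (2 * ?D)"
    using D card_labels_le[where 'n='n, of l] by (intro mult_right_mono) (auto simp only: of_nat_le_iff)
  also have "\<dots> = 2 * 2 ^ CARD('n) * (2 powr (real CARD('n) * real l) * ?D)"
    by (simp add: power_mult_distrib power_mult[symmetric] powr_realpow[symmetric] mult.commute)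
  finally show "cell_diff \<mu> \<nu> l n \<le> 2 * 2 ^ CARD('n) * (2 powr (real CARD('n) * real l) * ?D)" .
  have sum_le: "(\<Sum>z\<in>labels l. measure \<rho> (?c z)) \<le> measure \<rho> (shell -` {n})"
    if "prob_space \<rho>" and \<rho>: "sets \<rho> = sets borel" for \<rho> :: "(real ^ 'n) measure"
  proof -
    interpret prob_space \<rho> by fact
    have "(\<Sum>z\<in>labels l. measure \<rho> (?c z)) = measure \<rho> (\<Union>z\<in>labels l. ?c z)"
      by (rule finite_measure_finite_Union[symmetric])
        (auto simp: labels_finite \<rho> cell_vimage_borel disjoint_family_on_def)
    also have "\<dots> \<le> measure \<rho> (shell -` {n})"
      using measurable_sets[OF shell_measurable, of "{n}"]
      by (intro finite_measure_mono) (auto simp: cell_def \<rho>)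
    finally show ?thesis .
  qed
  have "cell_diff \<mu> \<nu> l n \<le> (\<Sum>z\<in>labels l. measure \<mu> (?c z) + measure \<nu> (?c z))"
    unfolding cell_diff_def
  proof (rule sum_mono)
    fix z :: "int ^ 'n"
    show "\<bar>measure \<mu> (?c z) - measure \<nu> (?c z)\<bar> \<le> measure \<mu> (?c z) + measure \<nu> (?c z)"
      using measure_nonneg[of \<mu> "?c z"] measure_nonneg[of \<nu> "?c z"] by linarith
  qed
  also have "\<dots> \<le> measure \<mu> (shell -` {n}) + measure \<nu> (shell -` {n})"
    unfolding sum.distrib using assms by (intro add_mono sum_le)
  finally show "cell_diff \<mu> \<nu> l n \<le> measure \<mu> (shell -` {n}) + measure \<nu> (shell -` {n})" .
qed

lemma coupling_marginals:
  fixes \<mu> \<nu> :: "'a::topological_space measure"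
  assumes \<pi>: "\<pi> \<in> couplings \<mu> \<nu>" and sets: "sets \<mu> = sets borel" "sets \<nu> = sets borel"
    and A: "A \<in> sets borel"
  shows "measure \<pi> (A \<times> UNIV) = measure \<mu> A" and "measure \<pi> (UNIV \<times> A) = measure \<nu> A"
proof -
  have s: "sets \<pi> = sets (\<mu> \<Otimes>\<^sub>M \<nu>)" and d: "distr \<pi> \<mu> fst = \<mu>" "distr \<pi> \<nu> snd = \<nu>"
    using \<pi> by (auto simp: couplings_def)
  have "space \<mu> = UNIV" "space \<nu> = UNIV" using sets by (auto dest: sets_eq_imp_space_eq)
  then have sp: "space \<pi> = UNIV" using sets_eq_imp_space_eq[OF s] by (simp add: space_pair_measure)
  have "measure \<pi> (A \<times> UNIV) = measure (distr \<pi> \<mu> fst) A"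
    using A sets by (subst measure_distr) (auto simp: measurable_cong_sets[OF s refl] sp fst_vimage_eq_Times)
  then show "measure \<pi> (A \<times> UNIV) = measure \<mu> A" using d by simp
  have "measure \<pi> (UNIV \<times> A) = measure (distr \<pi> \<nu> snd) A"
    using A sets by (subst measure_distr) (auto simp: measurable_cong_sets[OF s refl] sp snd_vimage_eq_Times)
  then show "measure \<pi> (UNIV \<times> A) = measure \<nu> A" using d by simp
qed

lemma shell_snd_cell: "(shell x, snd (cell l x)) = cell l x"
  by (simp add: cell_def)

lemma le_suminf_ennreal: "f n \<le> (\<Sum>n. f n :: ennreal)"
  using sum_le_suminf[of f "{n}"] by simp

text \<open>A pair separated at level \<open>l\<close> lies in \<open>C \<times> (UNIV - C)\<close>,
  where \<open>C\<close> is the cell of its first point. By \<open>diag\<close> this set has mass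
  \<open>\<mu> C - min (\<mu> C) (\<nu> C)\<close>, and the weight is constant on it since it
  depends only on the shell. The second bound exchanges the roles of the points.\<close>

lemma mismatch_integral_le:
  fixes \<mu> \<nu> :: "(real ^ 'n) measure" and g :: "nat \<Rightarrow> ennreal"
  assumes \<pi>: "\<pi> \<in> couplings \<mu> \<nu>" and sets: "sets \<mu> = sets borel" "sets \<nu> = sets borel"
    and prob: "prob_space \<mu>" "prob_space \<nu>"
    and diag: "\<And>c. emeasure \<pi> (cell l -` {c} \<times> cell l -` {c})
      = min (emeasure \<mu> (cell l -` {c})) (emeasure \<nu> (cell l -` {c}))"
  shows "(\<integral>\<^sup>+z. g (shell (fst z)) * indicator {z. cell l (fst z) \<noteq> cell l (snd z)} z \<partial>\<pi>)
      \<le> (\<Sum>n. g n * ennreal (cell_diff \<mu> \<nu> l n))" (is "?I1 \<le> ?R")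
    and "(\<integral>\<^sup>+z. g (shell (snd z)) * indicator {z. cell l (fst z) \<noteq> cell l (snd z)} z \<partial>\<pi>)
      \<le> (\<Sum>n. g n * ennreal (cell_diff \<mu> \<nu> l n))" (is "?I2 \<le> _")
proof -
  interpret \<pi>: prob_space \<pi> using \<pi> by (auto simp: couplings_def)
  interpret \<mu>: prob_space \<mu> by fact
  interpret \<nu>: prob_space \<nu> by fact
  have s: "sets \<pi> = sets (borel \<Otimes>\<^sub>M borel)"
    using \<pi> sets by (auto simp: couplings_def cong: sets_pair_measure_cong)
  let ?C = "\<lambda>n z. cell l -` {(n, z)} :: (real ^ 'n) set"
  have C: "?C n z \<in> sets borel" for n z by (rule cell_vimage_borel)
  have diag': "measure \<pi> (?C n z \<times> ?C n z) = min (measure \<mu> (?C n z)) (measure \<nu> (?C n z))" for n z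
    using diag[of "(n, z)"]
    by (simp add: \<pi>.emeasure_eq_measure \<mu>.emeasure_eq_measure \<nu>.emeasure_eq_measure min_def split: if_splits)
  \<comment> \<open>\<open>X n c\<close> will be a cell times its complement, or the reverse, so
    that one argument yields both bounds.\<close>
  have *: "(\<integral>\<^sup>+z. G z \<partial>\<pi>) \<le> ?R"
    if G: "\<And>z. G z \<le> (\<Sum>n. \<Sum>c\<in>labels l. g n * indicator (X n c) z)"
      and X: "\<And>n c. X n c \<in> sets \<pi>"
        "\<And>n c. measure \<pi> (X n c) \<le> \<bar>measure \<mu> (?C n c) - measure \<nu> (?C n c)\<bar>" for G X
  proof -
    have "(\<integral>\<^sup>+z. G z \<partial>\<pi>) \<le> (\<integral>\<^sup>+z. (\<Sum>n. \<Sum>c\<in>labels l. g n * indicator (X n c) z) \<partial>\<pi>)"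
      by (intro nn_integral_mono G)
    also have "\<dots> = (\<Sum>n. \<Sum>c\<in>labels l. g n * emeasure \<pi> (X n c))"
      using X(1) by (simp add: nn_integral_suminf nn_integral_sum nn_integral_cmult_indicator)
    also have "\<dots> \<le> ?R"
    proof (intro suminf_le summableI)
      fix n
      have "(\<Sum>c\<in>labels l. g n * emeasure \<pi> (X n c))
          \<le> (\<Sum>c\<in>labels l. g n * ennreal \<bar>measure \<mu> (?C n c) - measure \<nu> (?C n c)\<bar>)"
        unfolding \<pi>.emeasure_eq_measure by (intro sum_mono mult_left_mono ennreal_leI X) auto
      also have "\<dots> = g n * ennreal (cell_diff \<mu> \<nu> l n)"
        by (simp add: cell_diff_def sum_ennreal flip: sum_distrib_left)
      finally show "(\<Sum>c\<in>labels l. g n * emeasure \<pi> (X n c)) \<le> g n * ennreal (cell_diff \<mu> \<nu> l n)" .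
    qed
    finally show ?thesis .
  qed
  have single: "g n \<le> (\<Sum>n. \<Sum>c\<in>labels l. g n * indicator (X n c) z)"
    if "z \<in> X n c" "c \<in> labels l" for z n c and X :: "nat \<Rightarrow> int ^ 'n \<Rightarrow> ((real ^ 'n) \<times> (real ^ 'n)) set"
  proof -
    have "g n = g n * indicator (X n c) z" using that by simp
    also have "\<dots> \<le> (\<Sum>c\<in>labels l. g n * indicator (X n c) z)"
      by (rule member_le_sum) (auto simp: that labels_finite)
    also have "\<dots> \<le> (\<Sum>n. \<Sum>c\<in>labels l. g n * indicator (X n c) z)" by (rule le_suminf_ennreal)
    finally show ?thesis .
  qed
  show "?I1 \<le> ?R"
  proof (rule *)
    fix z :: "(real ^ 'n) \<times> (real ^ 'n)"
    show "g (shell (fst z)) * indicator {z. cell l (fst z) \<noteq> cell l (snd z)} z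
        \<le> (\<Sum>n. \<Sum>c\<in>labels l. g n * indicator (?C n c \<times> (UNIV - ?C n c)) z)"
      using single[of z "\<lambda>n c. ?C n c \<times> (UNIV - ?C n c)" "shell (fst z)" "snd (cell l (fst z))"]
      by (cases z) (auto simp: cell_label shell_snd_cell split: split_indicator)
  next
    fix n and c :: "int ^ 'n"
    show "?C n c \<times> (UNIV - ?C n c) \<in> sets \<pi>" unfolding s using C by (intro pair_measureI) auto
    have "?C n c \<times> (UNIV - ?C n c) = ?C n c \<times> UNIV - ?C n c \<times> ?C n c" by auto
    then have "measure \<pi> (?C n c \<times> (UNIV - ?C n c)) = measure \<pi> (?C n c \<times> UNIV) - measure \<pi> (?C n c \<times> ?C n c)"
      using C by (simp add: \<pi>.finite_measure_Diff s subset_eq)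
    then show "measure \<pi> (?C n c \<times> (UNIV - ?C n c)) \<le> \<bar>measure \<mu> (?C n c) - measure \<nu> (?C n c)\<bar>"
      unfolding coupling_marginals[OF \<pi> sets C] diag' by linarith
  qed
  show "?I2 \<le> ?R"
  proof (rule *)
    fix z :: "(real ^ 'n) \<times> (real ^ 'n)"
    show "g (shell (snd z)) * indicator {z. cell l (fst z) \<noteq> cell l (snd z)} z
        \<le> (\<Sum>n. \<Sum>c\<in>labels l. g n * indicator ((UNIV - ?C n c) \<times> ?C n c) z)"
      using single[of z "\<lambda>n c. (UNIV - ?C n c) \<times> ?C n c" "shell (snd z)" "snd (cell l (snd z))"]
      by (cases z) (auto simp: cell_label shell_snd_cell split: split_indicator)
  next
    fix n and c :: "int ^ 'n"
    show "(UNIV - ?C n c) \<times> ?C n c \<in> sets \<pi>" unfolding s using C by (intro pair_measureI) auto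
    have "(UNIV - ?C n c) \<times> ?C n c = UNIV \<times> ?C n c - ?C n c \<times> ?C n c" by auto
    then have "measure \<pi> ((UNIV - ?C n c) \<times> ?C n c) = measure \<pi> (UNIV \<times> ?C n c) - measure \<pi> (?C n c \<times> ?C n c)"
      using C by (simp add: \<pi>.finite_measure_Diff s subset_eq)
    then show "measure \<pi> ((UNIV - ?C n c) \<times> ?C n c) \<le> \<bar>measure \<mu> (?C n c) - measure \<nu> (?C n c)\<bar>"
      unfolding coupling_marginals[OF \<pi> sets C] diag' by linarith
  qed
qed

text \<open>Handles the leftover term of \<open>cell_cost_le\<close>, whose weight depends on the
  shell of the first point alone.\<close>

lemma shell_integral_le:
  fixes \<mu> \<nu> :: "(real ^ 'n) measure" and g :: "nat \<Rightarrow> ennreal"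
  assumes \<pi>: "\<pi> \<in> couplings \<mu> \<nu>" and sets: "sets \<mu> = sets borel" "sets \<nu> = sets borel"
  shows "(\<integral>\<^sup>+z. g (shell (fst z)) \<partial>\<pi>) \<le> (\<Sum>n. g n * ennreal (measure \<mu> (shell -` {n})))"
proof -
  interpret \<pi>: prob_space \<pi> using \<pi> by (auto simp: couplings_def)
  have s: "sets \<pi> = sets (borel \<Otimes>\<^sub>M borel)"
    using \<pi> sets by (auto simp: couplings_def cong: sets_pair_measure_cong)
  let ?S = "\<lambda>n. shell -` {n} :: (real ^ 'n) set"
  have S: "?S n \<in> sets borel" for n using measurable_sets[OF shell_measurable, of "{n}"] by simp
  have S': "?S n \<times> UNIV \<in> sets \<pi>" for n unfolding s using S by (intro pair_measureI) auto
  have "(\<integral>\<^sup>+z. g (shell (fst z)) \<partial>\<pi>) \<le> (\<integral>\<^sup>+z. (\<Sum>n. g n * indicator (?S n \<times> UNIV) z) \<partial>\<pi>)"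
  proof (intro nn_integral_mono)
    fix z :: "(real ^ 'n) \<times> (real ^ 'n)"
    show "g (shell (fst z)) \<le> (\<Sum>n. g n * indicator (?S n \<times> UNIV) z)"
      using le_suminf_ennreal[of "\<lambda>n. g n * indicator (?S n \<times> UNIV) z" "shell (fst z)"]
      by (cases z) simp
  qed
  also have "\<dots> = (\<Sum>n. g n * emeasure \<pi> (?S n \<times> UNIV))"
    using S' by (simp add: nn_integral_suminf nn_integral_cmult_indicator)
  finally show ?thesis by (simp add: \<pi>.emeasure_eq_measure coupling_marginals[OF \<pi> sets S])
qed

lemma suminf_ennreal_le:
  fixes f :: "nat \<Rightarrow> ennreal"
  assumes "\<And>k. (\<Sum>n<k. f n) \<le> B"
  shows "(\<Sum>n. f n) \<le> B"
  unfolding suminf_eq_SUP by (rule SUP_least) (rule assms)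

lemma wasserstein_powr_le:
  assumes "\<pi> \<in> couplings \<mu> \<nu>" "0 < p"
  shows "ennreal_powr (wasserstein N p \<mu> \<nu>) p \<le> (\<integral>\<^sup>+z. ennreal (N (fst z - snd z) powr p) \<partial>\<pi>)"
proof -
  have "wasserstein N p \<mu> \<nu> \<le> ennreal_powr (\<integral>\<^sup>+(x, y). ennreal (N (x - y) powr p) \<partial>\<pi>) (1 / p)"
    unfolding wasserstein_def using assms(1) by (rule INF_lower)
  then have "ennreal_powr (wasserstein N p \<mu> \<nu>) p
      \<le> ennreal_powr (ennreal_powr (\<integral>\<^sup>+(x, y). ennreal (N (x - y) powr p) \<partial>\<pi>) (1 / p)) p"
    using assms(2) by (intro ennreal_powr_mono) auto
  then show ?thesis using assms(2) by (simp add: ennreal_powr_inverse split_beta')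
qed

text \<open>Integrates \<open>cell_cost_le\<close> against the coupling adapted to the levels up to
  \<open>L\<close>. The mismatches give \<open>2 * T\<close>; the leftover term sums
  \<open>2^(p n - p L)\<close> against the tail \<open>B * 2^(- q n)\<close>, a geometric series of
  ratio \<open>2 powr (p - q)\<close>.\<close>

lemma transport_cost_le:
  fixes N :: "real ^ 'n \<Rightarrow> real" and \<mu> \<nu> :: "(real ^ 'n) measure"
  assumes N: "is_norm N" and p: "0 < p" "p < q" and B: "0 \<le> B"
    and sets: "sets \<mu> = sets borel" "sets \<nu> = sets borel"
    and prob: "prob_space \<mu>" "prob_space \<nu>"
    and tail: "\<And>n. measure \<mu> (shell -` {n}) \<le> B * 2 powr (- q * real n)"
    and diff: "\<And>a. (\<Sum>n<a. \<Sum>l\<le>L. 2 powr (p * real n - p * real l) * cell_diff \<mu> \<nu> l n) \<le> T"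
  shows "ennreal_powr (wasserstein N p \<mu> \<nu>) p \<le> ennreal ((2 * (\<Sum>i\<in>UNIV. N (axis i 1))) powr p *
    (2 * T + B / (1 - 2 powr (p - q)) * 2 powr (- p * real L)))"
proof -
  define w where "w = (\<lambda>l n. 2 powr (p * real n - p * real l))"
  define c where "c = (2 * (\<Sum>i\<in>UNIV. N (axis i 1))) powr p"
  have nonneg: "0 \<le> w l n" "0 \<le> c" "0 \<le> cell_diff \<mu> \<nu> l n" for l n
    by (auto simp: w_def c_def cell_diff_def intro: sum_nonneg)
  obtain \<pi> where \<pi>: "\<pi> \<in> couplings \<mu> \<nu>"
    and diag: "\<And>l c. l < Suc L \<Longrightarrow> emeasure \<pi> (cell l -` {c} \<times> cell l -` {c})
       = min (emeasure \<mu> (cell l -` {c})) (emeasure \<nu> (cell l -` {c}))"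
    using nested_partitions_coupling[where f = cell and k = "Suc L", OF cell_measurable cell_nested prob sets] by auto
  have s [measurable_cong]: "sets \<pi> = sets (borel \<Otimes>\<^sub>M borel)"
    using \<pi> sets by (auto simp: couplings_def cong: sets_pair_measure_cong)
  have cell_fst: "(\<lambda>z. cell l (fst z)) \<in> measurable \<pi> (count_space UNIV)"
    and cell_snd: "(\<lambda>z. cell l (snd z)) \<in> measurable \<pi> (count_space UNIV)"
    and shell_fst [measurable]: "(\<lambda>z. shell (fst z)) \<in> measurable \<pi> (count_space UNIV)"
    and shell_snd [measurable]: "(\<lambda>z. shell (snd z)) \<in> measurable \<pi> (count_space UNIV)" for l
    unfolding measurable_cong_sets[OF s refl]
    by (rule measurable_compose[OF measurable_fst cell_measurable]
        measurable_compose[OF measurable_snd cell_measurable]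
        measurable_compose[OF measurable_fst shell_measurable]
        measurable_compose[OF measurable_snd shell_measurable])+
  let ?ne = "\<lambda>l. {z. cell l (fst z) \<noteq> cell l (snd z)} :: ((real ^ 'n) \<times> (real ^ 'n)) set"
  have sp: "space \<pi> = UNIV" using sets_eq_imp_space_eq[OF s] by (simp add: space_pair_measure)
  have ne [measurable]: "?ne l \<in> sets \<pi>" for l
  proof -
    have "{z \<in> space \<pi>. cell l (fst z) \<noteq> cell l (snd z)} \<in> sets \<pi>"
      using cell_fst[of l] cell_snd[of l] by measurable
    then show ?thesis by (simp add: sp)
  qed
  let ?u = "\<lambda>l z. ennreal (w l (shell (fst z))) * indicator (?ne l) z"
  let ?v = "\<lambda>l z. ennreal (w l (shell (snd z))) * indicator (?ne l) z"
  let ?E = "\<lambda>l. \<Sum>n. ennreal (w l n) * ennreal (cell_diff \<mu> \<nu> l n)"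
  have pointwise: "ennreal (N (fst z - snd z) powr p)
      \<le> ennreal c * ((\<Sum>l\<le>L. ?u l z + ?v l z) + ennreal (w L (shell (fst z))))" for z
  proof -
    have X: "0 \<le> (w l (shell (fst z)) + w l (shell (snd z))) * of_bool (cell l (fst z) \<noteq> cell l (snd z))" for l
      using nonneg by simp
    have "ennreal (N (fst z - snd z) powr p) \<le> ennreal (c * ((\<Sum>l\<le>L. (w l (shell (fst z)) + w l (shell (snd z)))
        * of_bool (cell l (fst z) \<noteq> cell l (snd z))) + w L (shell (fst z))))"
      unfolding c_def w_def by (intro ennreal_leI cell_cost_le N p)
    also have "\<dots> = ennreal c * ((\<Sum>l\<le>L. ennreal ((w l (shell (fst z)) + w l (shell (snd z)))
        * of_bool (cell l (fst z) \<noteq> cell l (snd z)))) + ennreal (w L (shell (fst z))))"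
      by (simp only: sum_ennreal[OF X] ennreal_plus[OF sum_nonneg[OF X] nonneg(1), symmetric]
          ennreal_mult[OF nonneg(2) add_nonneg_nonneg[OF sum_nonneg[OF X] nonneg(1)]])
    also have "(\<Sum>l\<le>L. ennreal ((w l (shell (fst z)) + w l (shell (snd z)))
        * of_bool (cell l (fst z) \<noteq> cell l (snd z)))) = (\<Sum>l\<le>L. ?u l z + ?v l z)"
      using nonneg by (intro sum.cong) auto
    finally show ?thesis .
  qed
  have "(\<integral>\<^sup>+z. ennreal (N (fst z - snd z) powr p) \<partial>\<pi>)
      \<le> (\<integral>\<^sup>+z. ennreal c * ((\<Sum>l\<le>L. ?u l z + ?v l z) + ennreal (w L (shell (fst z)))) \<partial>\<pi>)"
    by (intro nn_integral_mono pointwise)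
  also have "\<dots> = ennreal c * ((\<Sum>l\<le>L. (\<integral>\<^sup>+z. ?u l z \<partial>\<pi>) + (\<integral>\<^sup>+z. ?v l z \<partial>\<pi>))
      + (\<integral>\<^sup>+z. ennreal (w L (shell (fst z))) \<partial>\<pi>))"
    by (simp add: nn_integral_cmult nn_integral_add nn_integral_sum)
  also have "\<dots> \<le> ennreal c * ((\<Sum>l\<le>L. ?E l + ?E l)
      + (\<Sum>n. ennreal (w L n) * ennreal (measure \<mu> (shell -` {n}))))"
    by (intro mult_left_mono add_mono sum_mono mismatch_integral_le[OF \<pi> sets prob diag]
        shell_integral_le[OF \<pi> sets, where g = "\<lambda>n. ennreal (w L n)"]) auto
  also have "\<dots> \<le> ennreal c * (ennreal (2 * T) + ennreal (B / (1 - 2 powr (p - q)) * 2 powr (- p * real L)))"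
  proof (intro mult_left_mono add_mono)
    \<comment> \<open>The sums over levels and shells are exchanged because \<open>diff\<close>
      bounds partial sums over shells; the factor 2 collects the contributions of both
      points.\<close>
    have "(\<Sum>l\<le>L. ?E l + ?E l) = (\<Sum>l\<le>L. \<Sum>n. ennreal (2 * (w l n * cell_diff \<mu> \<nu> l n)))"
      using nonneg by (simp add: suminf_add ennreal_mult[symmetric] ennreal_plus[symmetric] del: ennreal_plus)
    also have "\<dots> = (\<Sum>n. \<Sum>l\<le>L. ennreal (2 * (w l n * cell_diff \<mu> \<nu> l n)))"
      by (rule suminf_sum[symmetric]) simp
    also have "\<dots> \<le> ennreal (2 * T)"
    proof (rule suminf_ennreal_le)
      fix a
      have "(\<Sum>n<a. \<Sum>l\<le>L. ennreal (2 * (w l n * cell_diff \<mu> \<nu> l n)))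
          = ennreal (2 * (\<Sum>n<a. \<Sum>l\<le>L. w l n * cell_diff \<mu> \<nu> l n))"
        using nonneg by (simp add: sum_ennreal sum_nonneg flip: sum_distrib_left)
      also have "\<dots> \<le> ennreal (2 * T)" using diff[of a] by (intro ennreal_leI) (simp add: w_def)
      finally show "(\<Sum>n<a. \<Sum>l\<le>L. ennreal (2 * (w l n * cell_diff \<mu> \<nu> l n))) \<le> ennreal (2 * T)" .
    qed
    finally show "(\<Sum>l\<le>L. ?E l + ?E l) \<le> ennreal (2 * T)" .
    show "(\<Sum>n. ennreal (w L n) * ennreal (measure \<mu> (shell -` {n})))
        \<le> ennreal (B / (1 - 2 powr (p - q)) * 2 powr (- p * real L))"
    proof (rule suminf_ennreal_le)
      fix a
      define x where "x = 2 powr (p - q)"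
      have x: "0 < x" "x < 1" unfolding x_def using p powr_less_mono[of "p - q" 0 2] by auto
      have "w L n * measure \<mu> (shell -` {n}) \<le> B * 2 powr (- p * real L) * x ^ n" for n
      proof -
        have "w L n * measure \<mu> (shell -` {n}) \<le> w L n * (B * 2 powr (- q * real n))"
          using nonneg tail by (intro mult_left_mono)
        also have "\<dots> = B * 2 powr (- p * real L) * 2 powr ((p - q) * real n)"
          by (simp add: w_def powr_add[symmetric] mult.commute mult.left_commute algebra_simps)
        also have "2 powr ((p - q) * real n) = x ^ n"
          by (simp add: x_def powr_powr[symmetric] powr_realpow)
        finally show ?thesis .
      qed
      then have "(\<Sum>n<a. w L n * measure \<mu> (shell -` {n})) \<le> (\<Sum>n<a. B * 2 powr (- p * real L) * x ^ n)"
        by (rule sum_mono)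
      also have "\<dots> = B * 2 powr (- p * real L) * (\<Sum>n<a. x ^ n)" by (simp add: sum_distrib_left)
      also have "\<dots> \<le> B * 2 powr (- p * real L) * (1 / (1 - x))"
      proof (intro mult_left_mono)
        have "(\<Sum>n<a. x ^ n) \<le> (\<Sum>n. x ^ n)" using x by (intro sum_le_suminf) auto
        then show "(\<Sum>n<a. x ^ n) \<le> 1 / (1 - x)" using x by (simp add: suminf_geometric)
      qed (use B in auto)
      finally have "(\<Sum>n<a. w L n * measure \<mu> (shell -` {n})) \<le> B / (1 - x) * 2 powr (- p * real L)"
        by (simp add: mult.commute)
      then have "ennreal (\<Sum>n<a. w L n * measure \<mu> (shell -` {n}))
          \<le> ennreal (B / (1 - x) * 2 powr (- p * real L))" by (rule ennreal_leI)
      then show "(\<Sum>n<a. ennreal (w L n) * ennreal (measure \<mu> (shell -` {n})))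
          \<le> ennreal (B / (1 - 2 powr (p - q)) * 2 powr (- p * real L))"
        using nonneg by (simp add: x_def sum_ennreal flip: ennreal_mult)
    qed
  qed auto
  also have "\<dots> = ennreal (c * (2 * T + B / (1 - 2 powr (p - q)) * 2 powr (- p * real L)))"
  proof -
    \<comment> \<open>For \<open>a = 0\<close> the sum in \<open>diff\<close> is empty.\<close>
    have "0 \<le> T" using diff[of 0] by simp
    moreover have "2 powr (p - q) \<le> 1" using p powr_mono[of "p - q" 0 2] by simp
    ultimately have nn: "0 \<le> 2 * T" "0 \<le> B / (1 - 2 powr (p - q)) * 2 powr (- p * real L)"
      using B by simp_all
    show ?thesis
      by (simp only: ennreal_plus[OF nn] ennreal_mult[OF nonneg(2) add_nonneg_nonneg[OF nn]])
  qed
  finally show ?thesis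
    unfolding c_def using wasserstein_powr_le[OF \<pi> p(1), of N] by (rule order_trans[rotated])
qed

section \<open>Choice of the constants and passage to the limit\<close>

theorem theorem3p2:
  fixes N :: "real ^ 'n \<Rightarrow> real" and p q d :: real
  defines "d \<equiv> real CARD('n)"
  assumes "is_norm N"
    and "1 \<le> p" and "p < q"
    and "p < d * q / (q + d) \<or> (d * q / (q + d) < p \<and> p \<noteq> d)"
  shows "\<exists>\<kappa>::real. 0 < \<kappa> \<and>
    (\<forall>\<mu> \<nu> :: (real ^ 'n) measure.
       prob_space \<mu> \<longrightarrow> sets \<mu> = sets borel \<longrightarrow> moment N \<mu> q < \<top> \<longrightarrow>
       prob_space \<nu> \<longrightarrow> sets \<nu> = sets borel \<longrightarrow> moment N \<nu> q < \<top> \<longrightarrow>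
       ennreal_powr (wasserstein N p \<mu> \<nu>) p \<le>
         ennreal \<kappa> * max (moment N (scale_measure (1 / 2) (measure_sum \<mu> \<nu>)) q) 1 *
         ennreal (if p < d * q / (q + d)
                  then unif_discrepancy \<mu> \<nu> powr (p / d)
                  else unif_discrepancy \<mu> \<nu> powr (1 - p / q)))"
proof -
  have d: "0 < d" by (simp add: d_def)
  have pq: "0 < p" "0 < q" using assms by auto
  define \<rho> where "\<rho> = (if p < d * q / (q + d) then p / d else 1 - p / q)"
  \<comment> \<open>\<open>d * q / (q + d)\<close> is the value of \<open>p\<close> at which
    \<open>p / d\<close> and \<open>1 - p / q\<close> coincide.\<close>
  have iff: "p < d * q / (q + d) \<longleftrightarrow> p / d < 1 - p / q" "d * q / (q + d) < p \<longleftrightarrow> 1 - p / q < p / d"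
    using d pq by (simp_all add: field_simps)
  have \<rho>: "p / d < 1 - p / q \<and> \<rho> = p / d \<or> 1 - p / q < p / d \<and> \<rho> = 1 - p / q"
    using assms(5) unfolding \<rho>_def iff by auto
  obtain C2 where C2: "0 < C2" "\<And>D a b. 0 \<le> D \<Longrightarrow> (\<Sum>n<a. \<Sum>l<b. 2 powr (p * real n - p * real l) *
      min (2 powr (d * real l) * D) (2 powr (- q * real n))) \<le> C2 * D powr \<rho>"
    using multiscale_sum_bound[OF d pq(1) \<open>p < q\<close> \<rho>] by blast
  obtain C where C: "0 < C" "\<And>(\<mu> :: (real ^ 'n) measure) \<nu> m n. prob_space \<mu> \<Longrightarrow> prob_space \<nu> \<Longrightarrow>
    sets \<mu> = sets borel \<Longrightarrow> sets \<nu> = sets borel \<Longrightarrow> 1 \<le> m \<Longrightarrow>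
    moment N (scale_measure (1 / 2) (measure_sum \<mu> \<nu>)) q \<le> ennreal m \<Longrightarrow>
    measure \<mu> (shell -` {n}) + measure \<nu> (shell -` {n}) \<le> C * m * 2 powr (- q * real n)"
    using shell_tail_bound[OF \<open>is_norm N\<close> pq(2)] by blast
  \<comment> \<open>Dominates the constants of both bounds on \<open>cell_diff\<close>.\<close>
  define C1 where "C1 = 2 * 2 ^ CARD('n) + C"
  define c where "c = (2 * (\<Sum>i\<in>UNIV. N (axis i 1))) powr p"
  have c: "0 \<le> c" by (simp add: c_def)
  have C1: "0 < C1" unfolding C1_def using C(1) by (intro add_pos_pos) auto
  \<comment> \<open>The summand 1 gives positivity from \<open>0 \<le> c\<close> alone.\<close>
  define \<kappa> where "\<kappa> = 2 * c * C1 * C2 + 1"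
  have \<kappa>: "0 < \<kappa>" unfolding \<kappa>_def using c C1 C2(1) by (intro add_nonneg_pos mult_nonneg_nonneg) auto
  have "ennreal_powr (wasserstein N p \<mu> \<nu>) p \<le> ennreal \<kappa> *
      max (moment N (scale_measure (1 / 2) (measure_sum \<mu> \<nu>)) q) 1 * ennreal (unif_discrepancy \<mu> \<nu> powr \<rho>)"
    if prob: "prob_space \<mu>" "prob_space \<nu>" and sets: "sets \<mu> = sets borel" "sets \<nu> = sets borel"
      and mom: "moment N \<mu> q < \<top>" "moment N \<nu> q < \<top>" for \<mu> \<nu> :: "(real ^ 'n) measure"
  proof -
    let ?M = "max (moment N (scale_measure (1 / 2) (measure_sum \<mu> \<nu>)) q) 1"
    define D where "D = unif_discrepancy \<mu> \<nu>"
    \<comment> \<open>The finite moments make the maximum a real number, so the estimates can be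
      carried out in the reals.\<close>
    define m where "m = enn2real ?M"
    have D: "0 \<le> D" unfolding D_def using prob by (rule unif_discrepancy_nonneg)
    have [measurable]: "N \<in> borel_measurable borel"
      using is_norm_continuous_on[OF \<open>is_norm N\<close>] by (rule borel_measurable_continuous_onI)
    have Nq: "(\<lambda>x. ennreal (N x powr q)) \<in> borel_measurable \<mu>"
      unfolding measurable_cong_sets[OF sets(1) refl] by measurable
    have "moment N (scale_measure (1 / 2) (measure_sum \<mu> \<nu>)) q = (1 / 2) * (moment N \<mu> q + moment N \<nu> q)"
      unfolding moment_def using Nq sets
      by (subst nn_integral_scale_measure) (simp_all add: nn_integral_measure_sum cong: measurable_cong_sets)
    also have "\<dots> < \<top>"
      using mom ennreal_less_top[of "1 / 2", folded ennreal_half] by (simp add: ennreal_mult_less_top ennreal_divide_eq_top_iff less_top)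
    finally have M: "?M = ennreal m" unfolding m_def by (simp add: less_top)
    have m: "1 \<le> m"
    proof -
      have "ennreal 1 \<le> ennreal m" unfolding M[symmetric] by simp
      then show ?thesis by (subst (asm) ennreal_le_iff2) auto
    qed
    have momM: "moment N (scale_measure (1 / 2) (measure_sum \<mu> \<nu>)) q \<le> ennreal m"
      unfolding M[symmetric] by simp
    note tail = C(2)[OF prob sets m momM]
    have cell: "cell_diff \<mu> \<nu> l n \<le> C1 * m * min (2 powr (d * real l) * D) (2 powr (- q * real n))" for l n
    proof -
      \<comment> \<open>The discrepancy bound does not involve the moment; the factor
        \<open>m\<close> can be inserted because \<open>1 \<le> m\<close>.\<close>
      have "C1 * 1 * X \<le> C1 * m * X" if "0 \<le> X" for X
        using m C1 that by (intro mult_right_mono mult_left_mono) auto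
      moreover have "2 * 2 ^ CARD('n) * X \<le> C1 * X" if "0 \<le> X" for X
        using C(1) that unfolding C1_def by (intro mult_right_mono) auto
      ultimately have 1: "cell_diff \<mu> \<nu> l n \<le> C1 * m * (2 powr (d * real l) * D)"
        using cell_diff_le(1)[OF prob sets, of l n] D unfolding D_def[symmetric] d_def[symmetric]
        by (smt (verit) mult_nonneg_nonneg powr_ge_zero mult.right_neutral)
      have "C * m * X \<le> C1 * m * X" if "0 \<le> X" for X
        using m that unfolding C1_def by (intro mult_right_mono) auto
      then have 2: "cell_diff \<mu> \<nu> l n \<le> C1 * m * 2 powr (- q * real n)"
        using cell_diff_le(2)[OF prob sets, of l n] tail[of n] powr_ge_zero by (meson order_trans)
      show ?thesis using 1 2 by (simp add: min_def)
    qed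
    let ?T = "C1 * m * (C2 * D powr \<rho>)"
    have diff: "(\<Sum>n<a. \<Sum>l\<le>L. 2 powr (p * real n - p * real l) * cell_diff \<mu> \<nu> l n) \<le> ?T" for a L
    proof -
      have "(\<Sum>n<a. \<Sum>l\<le>L. 2 powr (p * real n - p * real l) * cell_diff \<mu> \<nu> l n)
          \<le> (\<Sum>n<a. \<Sum>l\<le>L. 2 powr (p * real n - p * real l) *
              (C1 * m * min (2 powr (d * real l) * D) (2 powr (- q * real n))))"
        by (intro sum_mono mult_left_mono cell) auto
      also have "\<dots> = C1 * m * (\<Sum>n<a. \<Sum>l<Suc L. 2 powr (p * real n - p * real l) *
              min (2 powr (d * real l) * D) (2 powr (- q * real n)))"
        by (simp only: sum_distrib_left lessThan_Suc_atMost mult.left_commute)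
      also have "\<dots> \<le> ?T" using C1 m D by (intro mult_left_mono C2(2)) auto
      finally show ?thesis .
    qed
    have tail1: "measure \<mu> (shell -` {n}) \<le> C * m * 2 powr (- q * real n)" for n
      using tail[of n] measure_nonneg[of \<nu> "shell -` {n}"] by linarith
    let ?A = "C * m / (1 - 2 powr (p - q))"
    \<comment> \<open>The coupling depends on \<open>L\<close> but the left side does not, so
      letting \<open>L\<close> tend to infinity removes the error term.\<close>
    have "ennreal_powr (wasserstein N p \<mu> \<nu>) p \<le> ennreal (c * (2 * ?T + ?A * 2 powr (- p * real L)))" for L
      unfolding c_def using C(1) m
      by (intro transport_cost_le \<open>is_norm N\<close> pq \<open>p < q\<close> sets prob tail1 diff) auto
    moreover have "(\<lambda>L. ennreal (c * (2 * ?T + ?A * 2 powr (- p * real L)))) \<longlonglongrightarrow> ennreal (c * (2 * ?T + ?A * 0))"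
    proof (intro tendsto_intros)
      have x: "0 < 2 powr (- p)" "2 powr (- p) < 1" using pq powr_less_mono[of "- p" 0 2] by auto
      have "2 powr (- p * real L) = (2 powr (- p)) ^ L" for L
        by (subst powr_realpow[symmetric]) (simp_all add: powr_powr)
      then show "(\<lambda>L. 2 powr (- p * real L)) \<longlonglongrightarrow> 0"
        using LIMSEQ_realpow_zero[of "2 powr (- p)"] x by simp
    qed
    ultimately have "ennreal_powr (wasserstein N p \<mu> \<nu>) p \<le> ennreal (c * (2 * ?T + ?A * 0))"
      by (intro LIMSEQ_le_const) auto
    also have "c * (2 * ?T + ?A * 0) = (2 * c * C1 * C2) * m * D powr \<rho>" by (simp add: ac_simps)
    also have "\<dots> \<le> \<kappa> * m * D powr \<rho>" using m by (intro mult_right_mono) (auto simp: \<kappa>_def)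
    also have "ennreal (\<kappa> * m * D powr \<rho>) = ennreal \<kappa> * ?M * ennreal (D powr \<rho>)"
      unfolding M using \<kappa> m by (simp add: ennreal_mult)
    finally show ?thesis by (simp add: D_def ennreal_leI)
  qed
  then show ?thesis
    using \<kappa> unfolding \<rho>_def by (intro exI[of _ \<kappa>]) (simp add: if_distrib[of "\<lambda>x. _ powr x"])
qed

end
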